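(* Let $G$ be a topological group, $X$ a compact metric $G$-system and $E=E(X)$ its enveloping semigroup. The following are equivalent: (1) $(G,X)$ is RN. (2) For every closed subspace $Y\subset X$ (equivalently, for every closed $G$-invariant subspace $Y\subset X$) there exists a dense $G_\delta$ subset $Y_0$ of $Y$ such that for every $p\in E$ the induced map $p:Y_0\to X$, $p(y):=py$, is continuous.
   Context: A compact metric $G$-system is a compact metrizable space $X$ with a (jointly) continuous left action of the topological group $G$; $\breve g:X\to X$, $x\mapsto gx$. The enveloping semigroup $E(X)$ is the closure of $\{\breve g:g\in G\}$ in $X^X$ with the pointwise convergence topology. RN: a Banach space $V$ is Asplund if every separable Banach subspace has separable dual. $\mathrm{Iso}(V)$ is the group of linear isometries of $V$ onto itself. $X$ is Radon-Nikodým (RN) if there exist an Asplund space $V$, a strongly continuous co-homomorphism $h:G\to\mathrm{Iso}(V)$ (i.e. $h(gg')=h(g')h(g)$, and $g\mapsto h(g)v$ is norm continuous for each $v$), and a bounded topological embedding $\alpha:X\to(V^*,\text{weak}^* )$ with $\alpha(gx)=g\alpha(x)$, where $(g\varphi)(v)=\varphi(h(g)(v))$. *)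

theory Defs
  imports "HOL-Analysis.Analysis" "HOL-Probability.Discrete_Topology"
begin

(* Class topological_group_add does not assume commutativity: it is the library's class of
   arbitrary (not necessarily Hausdorff) topological groups, written additively.
   The product g g' is g + g' and the neutral element is 0. *)

definition compact_metric_system ::
    "'x topology \<Rightarrow> ('g::topological_group_add \<Rightarrow> 'x \<Rightarrow> 'x) \<Rightarrow> bool" where
  "compact_metric_system X act \<longleftrightarrow>
     compact_space X \<and> metrizable_space X \<and>
     continuous_map (prod_topology euclidean X) X (\<lambda>(g, x). act g x) \<and>
     (\<forall>x\<in>topspace X. act 0 x = x) \<and>
     (\<forall>g g'. \<forall>x\<in>topspace X. act (g + g') x = act g (act g' x))"

(* Selfmaps of X are represented by extensional functions on topspace X. *)
definition enveloping_semigroup ::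
    "'x topology \<Rightarrow> ('g::topological_group_add \<Rightarrow> 'x \<Rightarrow> 'x) \<Rightarrow> ('x \<Rightarrow> 'x) set" where
  "enveloping_semigroup X act =
     product_topology (\<lambda>_. X) (topspace X) closure_of range (\<lambda>g. restrict (act g) (topspace X))"

(* A (real) Banach space V is a closed linear subspace of a Banach type, with the inherited norm;
   V = UNIV gives the type itself. This allows V to depend on terms, and to have Banach
   subspaces of the same kind. *)
definition banach_subspace :: "'b::banach set \<Rightarrow> bool" where
  "banach_subspace V \<longleftrightarrow> subspace V \<and> closed V"

(* Functionals live on V only, hence the extensionality: V is usually not the whole type. *)
definition dual :: "'b::banach set \<Rightarrow> ('b \<Rightarrow> real) set" where
  "dual V = {f \<in> extensional V.
     (\<forall>v\<in>V. \<forall>w\<in>V. f (v + w) = f v + f w) \<and>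
     (\<forall>c. \<forall>v\<in>V. f (c *\<^sub>R v) = c * f v) \<and>
     (\<exists>B. \<forall>v\<in>V. \<bar>f v\<bar> \<le> B * norm v)}"

definition dual_norm :: "'b::banach set \<Rightarrow> ('b \<Rightarrow> real) \<Rightarrow> real" where
  "dual_norm V f = (SUP v\<in>{v\<in>V. norm v \<le> 1}. \<bar>f v\<bar>)"

definition separable_dual :: "'b::banach set \<Rightarrow> bool" where
  "separable_dual V \<longleftrightarrow>
     (\<exists>D. countable D \<and> D \<subseteq> dual V \<and>
        (\<forall>f\<in>dual V. \<forall>e>0. \<exists>d\<in>D. dual_norm V (\<lambda>v. f v - d v) < e))"

definition weak_star :: "'b::banach set \<Rightarrow> ('b \<Rightarrow> real) topology" where
  "weak_star V = subtopology (product_topology (\<lambda>_. euclideanreal) V) (dual V)"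

definition asplund :: "'b::banach set \<Rightarrow> bool" where
  "asplund V \<longleftrightarrow> banach_subspace V \<and>
     (\<forall>W. banach_subspace W \<and> W \<subseteq> V \<and> separable_space (top_of_set W) \<longrightarrow> separable_dual W)"

definition Iso :: "'b::banach set \<Rightarrow> ('b \<Rightarrow> 'b) set" where
  "Iso V = {T \<in> extensional V. bij_betw T V V \<and>
     (\<forall>v\<in>V. \<forall>w\<in>V. T (v + w) = T v + T w) \<and>
     (\<forall>c. \<forall>v\<in>V. T (c *\<^sub>R v) = c *\<^sub>R T v) \<and>
     (\<forall>v\<in>V. norm (T v) = norm v)}"

definition strongly_continuous_cohom ::
    "'b::banach set \<Rightarrow> ('g::topological_group_add \<Rightarrow> 'b \<Rightarrow> 'b) \<Rightarrow> bool" where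
  "strongly_continuous_cohom V h \<longleftrightarrow>
     (\<forall>g. h g \<in> Iso V) \<and>
     (\<forall>g g'. h (g + g') = compose V (h g') (h g)) \<and>
     (\<forall>v\<in>V. continuous_on UNIV (\<lambda>g. h g v))"

definition dual_action ::
    "'b::banach set \<Rightarrow> ('g::topological_group_add \<Rightarrow> 'b \<Rightarrow> 'b) \<Rightarrow> 'g \<Rightarrow> ('b \<Rightarrow> real) \<Rightarrow> 'b \<Rightarrow> real" where
  "dual_action V h g \<phi> = (\<lambda>v\<in>V. \<phi> (h g v))"

(* Representability on an Asplund space that is a closed subspace of the Banach type 'b. *)
definition RN_over ::
    "'b::banach itself \<Rightarrow> 'x topology \<Rightarrow> ('g::topological_group_add \<Rightarrow> 'x \<Rightarrow> 'x) \<Rightarrow> bool" where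
  "RN_over _ X act \<longleftrightarrow>
     (\<exists>(V::'b set) h \<alpha>.
        asplund V \<and> strongly_continuous_cohom V h \<and>
        embedding_map X (weak_star V) \<alpha> \<and>
        (\<exists>B. \<forall>x\<in>topspace X. dual_norm V (\<alpha> x) \<le> B) \<and>
        (\<forall>g. \<forall>x\<in>topspace X. \<alpha> (act g x) = dual_action V h g (\<alpha> x)))"

instance bcontfun :: (metric_space, banach) banach ..

(* HOL cannot quantify over the type of V inside a formula, so the existential over all Asplund
   spaces ranges over the closed subspaces of l^infinity (bounded functions on a countable
   discrete space), which up to isometric isomorphism include all separable Banach spaces.
   That no representation is lost this way for compact metrizable X is not part of the definition;
   it is the claim "RN_over TYPE('b) X act implies RN X act" for an arbitrary Banach type 'b. *)
definition RN :: "'x topology \<Rightarrow> ('g::topological_group_add \<Rightarrow> 'x \<Rightarrow> 'x) \<Rightarrow> bool" where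
  "RN X act \<longleftrightarrow> RN_over TYPE(nat discrete \<Rightarrow>\<^sub>C real) X act"

definition generic_continuity ::
    "'x topology \<Rightarrow> ('g::topological_group_add \<Rightarrow> 'x \<Rightarrow> 'x) \<Rightarrow> 'x set \<Rightarrow> bool" where
  "generic_continuity X act Y \<longleftrightarrow>
     (\<exists>Y\<^sub>0. gdelta_in (subtopology X Y) Y\<^sub>0 \<and> subtopology X Y closure_of Y\<^sub>0 = Y \<and>
        (\<forall>p\<in>enveloping_semigroup X act. continuous_map (subtopology X Y\<^sub>0) X p))"

definition invariant_set :: "('g \<Rightarrow> 'x \<Rightarrow> 'x) \<Rightarrow> 'x set \<Rightarrow> bool" where
  "invariant_set act Y \<longleftrightarrow> (\<forall>g. act g ` Y \<subseteq> Y)"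

end

theory Submission
  imports Defs
begin

text \<open>
Let \<open>d\<close> be a metric for \<open>X\<close>. Representability on an Asplund space and generic continuity of the
enveloping semigroup are linked by a third property: the metric
\<open>orbit_dist x y = (SUP g. d (g x) (g y))\<close> on \<open>X\<close> is separable.

Representability implies generic continuity. A map \<open>\<alpha>\<close> of a closed set \<open>Y \<subseteq> X\<close> into a dual Asplund
space that is weak-star continuous is norm continuous at all points of a dense \<open>G\<^sub>\<delta>\<close> subset of \<open>Y\<close>
(\<open>asplund_norm_continuity_points\<close>, a Baire category argument in a separable subspace). As \<open>G\<close> acts by
isometries, norm continuity of \<open>\<alpha>\<close> at a point makes all translations equicontinuous there, and
equicontinuity passes to their pointwise limits (\<open>RN_over_imp_generic_continuity\<close>). The Banach space is
arbitrary here, so once the converse produces a space of bounded sequences, a representation over any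
Banach space can be replaced by one over the bounded sequences.

Generic continuity implies separability. Evaluation on \<open>E \<times> Y\<^sub>0\<close> is separately continuous, and a further
category argument yields a nonempty relatively open subset of \<open>Y\<close> of small \<open>orbit_dist\<close>-diameter
(\<open>generic_continuity_imp_small_open_set\<close>). Applied to the complement of the largest open set covered by
countably many small sets, which is closed and invariant, this shows that \<open>orbit_dist\<close> is separable
(\<open>orbit_dist_separable\<close>).

Separability implies representability. Instead of the interpolation space of Davis, Figiel, Johnson and
Pelczynski a concrete space is used: the continuous functions \<open>v\<close> for which
\<open>N\<^sub>n v = sup \<bar>v x - v y\<bar> / (2^n * orbit_dist x y + 2^-n)\<close> tends to 0, with norm the maximum of
\<open>sup \<bar>v\<bar>\<close> and \<open>sup N\<^sub>n v\<close>. The group acts on it by isometries \<open>v \<mapsto> v \<circ> g\<close>, and point evaluations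
embed \<open>X\<close> into its dual. Its subspaces have separable duals because the evaluations at the points of a
countable \<open>orbit_dist\<close>-dense set span a norm dense subspace (\<open>point_evaluations_norm_dense\<close>). A
functional \<open>\<phi>\<close> at positive distance from this span would be bounded away from 0 on a bounded sequence
that tends to 0 pointwise. By Simons' inequality (\<open>pointwise_null_imp_small_mixture\<close>) suitable convex
combinations tend to 0 uniformly, and since the \<open>N\<^sub>n\<close> form a \<open>c\<^sub>0\<close>-type norm, a gliding hump produces sums
of \<open>m\<close> such functions whose norms grow arbitrarily slowly with \<open>m\<close>, while \<open>\<phi>\<close> grows linearly: a contradiction.
\<close>

section \<open>Convex combinations of continuous functions\<close>

lemma compact_metrizable_imp_second_countable:
  assumes "compact_space X" "metrizable_space X"
  shows "second_countable X"
proof -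
  obtain M d where "Metric_space M d" and X: "X = Metric_space.mtopology M d"
    using assms(2) unfolding metrizable_space_def by blast
  interpret Metric_space M d by fact
  have tb: "mtotally_bounded M"
    using assms(1) X compact_space_eq_mcomplete_mtotally_bounded by auto
  have "\<exists>K. finite K \<and> K \<subseteq> M \<and> M \<subseteq> (\<Union>x\<in>K. mball x (inverse (Suc n)))" for n
    using tb unfolding mtotally_bounded_def by (meson inverse_Suc)
  then obtain K where K: "\<And>n. finite (K n)" "\<And>n. M \<subseteq> (\<Union>x\<in>K n. mball x (inverse (Suc n)))"
    by metis
  define \<B> where "\<B> = (\<Union>n. (\<lambda>x. mball x (inverse (Suc n))) ` K n)"
  show ?thesis
    unfolding second_countable_def
  proof (intro exI conjI strip)
    show "countable \<B>"
      unfolding \<B>_def using K(1) by (simp add: countable_finite)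
    show "openin X V" if "V \<in> \<B>" for V
      using that openin_mball unfolding X \<B>_def by blast
    show "\<exists>V\<in>\<B>. x \<in> V \<and> V \<subseteq> U" if "openin X U \<and> x \<in> U" for U x
    proof -
      have U: "openin mtopology U" "x \<in> U"
        using that X by simp_all
      then have "x \<in> M" "\<exists>r>0. mball x r \<subseteq> U"
        using openin_mtopology[of U] by blast+
      then obtain r where r: "r > 0" "mball x r \<subseteq> U"
        by blast
      obtain n where n: "inverse (Suc n) < r / 2"
        using reals_Archimedean[of "r/2"] r(1) by auto
      obtain z where z: "z \<in> K n" "x \<in> mball z (inverse (Suc n))"
        using K(2)[of n] \<open>x \<in> M\<close> by auto
      have "mball z (inverse (Suc n)) \<subseteq> mball x r"
      proof
        fix y assume y: "y \<in> mball z (inverse (Suc n))"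
        have "d x y \<le> d x z + d z y"
          using y z(2) by (intro triangle) auto
        moreover have "d x z < inverse (Suc n)" "d z y < inverse (Suc n)"
          using y z(2) by (auto simp: commute)
        ultimately have "d x y < r"
          using n by linarith
        then show "y \<in> mball x r"
          using y \<open>x \<in> M\<close> by auto
      qed
      then show ?thesis
        using z r(2) by (auto simp: \<B>_def)
    qed
  qed
qed

lemma continuous_map_attains_sup:
  fixes f :: "'x \<Rightarrow> real"
  assumes "compact_space X" "topspace X \<noteq> {}" "continuous_map X euclideanreal f"
  obtains b where "b \<in> topspace X" "\<And>x. x \<in> topspace X \<Longrightarrow> f x \<le> f b"
proof -
  have "compact (f ` topspace X)"
    using image_compactin[of X "topspace X" euclideanreal f] assms
    by (auto simp: compact_space_def)
  then obtain s where "s \<in> f ` topspace X" "\<forall>t\<in>f ` topspace X. t \<le> s"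
    using compact_attains_sup[of "f ` topspace X"] assms(2) by blast
  then show ?thesis
    using that by blast
qed

text \<open>
Finite convex combinations of members of \<open>A\<close>. Building them two at a time makes every
property that is stable under convex combinations provable by rule induction, so coefficient
families never appear.
\<close>
inductive_set mixtures :: "('x \<Rightarrow> real) set \<Rightarrow> ('x \<Rightarrow> real) set" for A where
  base: "f \<in> A \<Longrightarrow> f \<in> mixtures A"
| mix: "f \<in> mixtures A \<Longrightarrow> g \<in> mixtures A \<Longrightarrow> 0 \<le> t \<Longrightarrow> t \<le> 1
    \<Longrightarrow> (\<lambda>x. (1 - t) * f x + t * g x) \<in> mixtures A"

lemma mixtures_mono: "A \<subseteq> B \<Longrightarrow> mixtures A \<subseteq> mixtures B"
proof
  fix f assume "A \<subseteq> B" "f \<in> mixtures A"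
  from this(2,1) show "f \<in> mixtures B"
    by (induction) (auto intro: mixtures.intros)
qed

lemma mixtures_continuous:
  assumes "f \<in> mixtures A" "\<And>f. f \<in> A \<Longrightarrow> continuous_map X euclideanreal f"
  shows "continuous_map X euclideanreal f"
  using assms by induction (auto intro!: continuous_intros)

lemma mixtures_bounds:
  assumes "f \<in> mixtures A" "\<And>f. f \<in> A \<Longrightarrow> l \<le> f x \<and> f x \<le> u"
  shows "l \<le> f x \<and> f x \<le> (u::real)"
  using assms
proof induction
  case (mix f g t)
  then have f: "l \<le> f x" "f x \<le> u" and g: "l \<le> g x" "g x \<le> u" by auto
  have "(1 - t) * f x \<ge> (1-t) * l" "t * g x \<ge> t * l" "(1 - t) * f x \<le> (1-t) * u" "t * g x \<le> t * u"
    using f g mix.hyps by (simp_all add: mult_left_mono)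
  then show ?case by (simp add: algebra_simps)
qed auto

text \<open>
A pointwise null sequence of continuous functions with values in \<open>[0, 1]\<close> on a compact space has
uniformly small convex combinations. The usual derivation (Riesz representation, dominated
convergence and Mazur's theorem) is replaced by Simons' inequality. Suppose all mixtures have
supremum above \<open>\<delta>\<close>. Mixtures \<open>y n\<close> of the tail \<open>w n, w (n+1), ...\<close> are chosen
one after the other so that the supremum of \<open>\<Sum>k\<le>n. t^k * y k\<close> is almost as small as possible.
Convexity then keeps the increments of these suprema above \<open>t^n * \<delta>/2\<close>, so that where
a later partial sum attains its supremum, every earlier \<open>y n\<close> is at least \<open>\<delta>/4\<close>. By
compactness one point has this for all \<open>n\<close>, but there the \<open>y n\<close> tend to 0.
\<close>
theorem pointwise_null_imp_small_mixture:
  fixes w :: "nat \<Rightarrow> 'x \<Rightarrow> real"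
  assumes X: "compact_space X"
    and cont: "\<And>k. continuous_map X euclideanreal (w k)"
    and bds: "\<And>k x. x \<in> topspace X \<Longrightarrow> 0 \<le> w k x \<and> w k x \<le> 1"
    and null: "\<And>x. x \<in> topspace X \<Longrightarrow> (\<lambda>k. w k x) \<longlonglongrightarrow> 0"
    and "\<delta> > 0"
  shows "\<exists>u\<in>mixtures (range w). \<forall>x\<in>topspace X. u x \<le> \<delta>"
proof (rule ccontr)
  assume neg: "\<not> ?thesis"
  define H where "H n = mixtures (w ` {n..})" for n
  have H_range: "H n \<subseteq> mixtures (range w)" for n
    unfolding H_def by (rule mixtures_mono) auto
  have H_mono: "H n \<subseteq> H m" if "m \<le> n" for m n
    unfolding H_def by (rule mixtures_mono) (use that in auto)
  have H_cont: "continuous_map X euclideanreal y" if "y \<in> H n" for y n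
    using that cont unfolding H_def by (auto elim: mixtures_continuous)
  have H_bds: "0 \<le> y x \<and> y x \<le> 1" if "y \<in> H n" "x \<in> topspace X" for y n x
    using that(1) unfolding H_def by (rule mixtures_bounds) (use that(2) bds in auto)
  have big: "\<exists>x\<in>topspace X. \<delta> < y x" if "y \<in> H n" for y n
    using neg H_range that by force
  have w_H: "w n \<in> H n" for n
    by (auto simp: H_def intro: mixtures.base)
  have ne: "topspace X \<noteq> {}"
    using big[OF w_H] by auto
  then obtain x0 where x0: "x0 \<in> topspace X" by blast
  define S where "S f = (SUP x\<in>topspace X. f x)" for f :: "'x \<Rightarrow> real"
  have S_att: "\<exists>b\<in>topspace X. S f = f b \<and> (\<forall>x\<in>topspace X. f x \<le> f b)"
    if f: "continuous_map X euclideanreal f" for f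
  proof -
    obtain b where "b \<in> topspace X" "\<And>x. x \<in> topspace X \<Longrightarrow> f x \<le> f b"
      using continuous_map_attains_sup[OF X ne f] by blast
    moreover then have "S f = f b"
      unfolding S_def by (intro cSup_eq_maximum) auto
    ultimately show ?thesis by auto
  qed
  have S_ge: "f x \<le> S f" if "continuous_map X euclideanreal f" "x \<in> topspace X" for f x
    using S_att[OF that(1)] that(2) by auto
  have S_le: "S f \<le> c" if "continuous_map X euclideanreal f" "\<And>x. x \<in> topspace X \<Longrightarrow> f x \<le> c" for f c
    using S_att[OF that(1)] that(2) by auto
  \<comment> \<open>The ratio for which the tail of the geometric series is \<open>\<delta>/4\<close> times the term before it.\<close>
  define t where "t = \<delta> / (4 + \<delta>)"
  have t: "0 < t" "t < 1" "t / (1 - t) = \<delta> / 4"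
    using \<open>\<delta> > 0\<close> by (auto simp: t_def field_simps)
  \<comment> \<open>The admissible error in step \<open>n\<close>; relative to \<open>t^n\<close> the errors of all steps together cost at most half of \<open>\<delta>\<close>.\<close>
  define e where "e n = t ^ Suc n * \<delta> / 2 ^ (n + 3)" for n
  have e_pos: "e n > 0" for n
    using t \<open>\<delta> > 0\<close> by (simp add: e_def)
  have near: "\<exists>y\<in>H n. \<forall>y'\<in>H n. S (\<lambda>x. s x + t^n * y x) \<le> S (\<lambda>x. s x + t^n * y' x) + e n"
    if s: "continuous_map X euclideanreal s" for s n
  proof -
    let ?A = "(\<lambda>y. S (\<lambda>x. s x + t^n * y x)) ` H n"
    have bdd: "bdd_below ?A"
    proof (rule bdd_belowI)
      fix r assume "r \<in> ?A"
      then obtain y where y: "y \<in> H n" "r = S (\<lambda>x. s x + t^n * y x)" by auto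
      have "s x0 \<le> s x0 + t^n * y x0"
        using H_bds[OF y(1) x0] t by simp
      also have "\<dots> \<le> r"
        unfolding y(2) using s H_cont[OF y(1)] x0 by (intro S_ge) (auto intro!: continuous_intros)
      finally show "s x0 \<le> r" .
    qed
    have "Inf ?A < Inf ?A + e n" using e_pos by simp
    then obtain r where "r \<in> ?A" "r < Inf ?A + e n"
      using cInf_less_iff[OF _ bdd] w_H by blast
    then obtain y where y: "y \<in> H n" "S (\<lambda>x. s x + t^n * y x) < Inf ?A + e n" by auto
    have "S (\<lambda>x. s x + t^n * y x) \<le> S (\<lambda>x. s x + t^n * y' x) + e n" if "y' \<in> H n" for y'
      using y(2) cInf_lower[OF imageI[OF that] bdd] by linarith
    then show ?thesis using y(1) by auto
  qed
  define good where "good n s y \<longleftrightarrow> y \<in> H n \<and>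
    (\<forall>y'\<in>H n. S (\<lambda>x. s x + t^n * y x) \<le> S (\<lambda>x. s x + t^n * y' x) + e n)" for n s y
  define Y where "Y n s = (SOME y. good n s y)" for n s
  have Y: "good n s (Y n s)" if "continuous_map X euclideanreal s" for s n
    unfolding Y_def by (rule someI_ex[of "good n s"]) (use near[OF that, of n] in \<open>auto simp: good_def\<close>)
  define s where "s = rec_nat (\<lambda>_. 0) (\<lambda>n f x. f x + t^n * Y n f x)"
  define y where "y n = Y n (s n)" for n
  have s_0: "s 0 = (\<lambda>_. 0)" and s_Suc: "s (Suc n) = (\<lambda>x. s n x + t^n * y n x)" for n
    by (simp_all add: s_def y_def)
  have s_cont: "continuous_map X euclideanreal (s n)" for n
  proof (induction n)
    case (Suc n)
    then show ?case
      unfolding s_Suc y_def using H_cont[of "Y n (s n)" n] Y[OF Suc, of n]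
      by (intro continuous_intros) (auto simp: good_def)
  qed (simp add: s_0)
  have y_H: "y n \<in> H n" for n
    unfolding y_def using Y[OF s_cont] by (auto simp: good_def)
  have y_min: "S (s (Suc n)) \<le> S (\<lambda>x. s n x + t^n * y' x) + e n" if "y' \<in> H n" for n y'
    unfolding s_Suc y_def using Y[OF s_cont, of n] that by (auto simp: good_def)
  have y_bds: "0 \<le> y n x" "y n x \<le> 1" if "x \<in> topspace X" for n x
    using H_bds[OF y_H that] by auto
  have step: "S (s (Suc (Suc n))) - S (s (Suc n)) \<ge> t * (S (s (Suc n)) - S (s n)) - (1 + t) * e n" for n
  proof -
    \<comment> \<open>Competitor for \<open>y n\<close>: the mixture that turns the new partial sum into a convex combination of its two neighbours.\<close>
    define r where "r = t / (1 + t)"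
    have r: "(1 + t) * r = t" "0 \<le> r" "r \<le> 1" using t by (auto simp: r_def)
    define y' where "y' = (\<lambda>x. (1 - r) * y n x + r * y (Suc n) x)"
    have "y (Suc n) \<in> H n"
      using y_H[of "Suc n"] H_mono[of n "Suc n"] by auto
    then have "y' \<in> H n"
      unfolding y'_def H_def using y_H[of n] r unfolding H_def by (intro mixtures.mix) auto
    then have 1: "S (s (Suc n)) \<le> S (\<lambda>x. s n x + t^n * y' x) + e n"
      by (rule y_min)
    have "S (\<lambda>x. s n x + t^n * y' x) \<le> (t * S (s n) + S (s (Suc (Suc n)))) / (1 + t)"
    proof (rule S_le)
      show "continuous_map X euclideanreal (\<lambda>x. s n x + t^n * y' x)"
        using s_cont[of n] H_cont[OF \<open>y' \<in> H n\<close>] by (intro continuous_intros) auto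
      fix x assume x: "x \<in> topspace X"
      have "(1 + t) * y' x = (1 + t) * y n x - ((1 + t) * r) * y n x + ((1 + t) * r) * y (Suc n) x"
        unfolding y'_def by (simp add: algebra_simps)
      then have y': "(1 + t) * y' x = y n x + t * y (Suc n) x"
        unfolding r by (simp add: algebra_simps)
      have "(1 + t) * (s n x + t^n * y' x) = (1 + t) * s n x + t^n * ((1 + t) * y' x)"
        by (simp add: algebra_simps)
      also have "\<dots> = (1 + t) * s n x + t^n * (y n x + t * y (Suc n) x)"
        unfolding y' ..
      also have "\<dots> = t * s n x + s (Suc (Suc n)) x"
        by (simp add: s_Suc algebra_simps)
      also have "\<dots> \<le> t * S (s n) + S (s (Suc (Suc n)))"
        using S_ge[OF s_cont x] t by (intro add_mono mult_left_mono) auto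
      finally show "s n x + t^n * y' x \<le> (t * S (s n) + S (s (Suc (Suc n)))) / (1 + t)"
        using t by (simp add: field_simps)
    qed
    with 1 have "S (s (Suc n)) \<le> (t * S (s n) + S (s (Suc (Suc n)))) / (1 + t) + e n"
      by simp
    then have "(1 + t) * S (s (Suc n)) \<le> t * S (s n) + S (s (Suc (Suc n))) + (1 + t) * e n"
      using t by (simp add: field_simps)
    then show ?thesis by (simp add: algebra_simps)
  qed
  have incr: "S (s (Suc n)) - S (s n) \<ge> t^n * (\<delta> / 2 + \<delta> / 2 ^ Suc n)" for n
  proof (induction n)
    case 0
    obtain x where x: "x \<in> topspace X" "\<delta> < y 0 x" using big[OF y_H] by blast
    have "S (s 0) = 0" using S_att[OF s_cont[of 0]] by (auto simp: s_0)
    moreover have "y 0 x \<le> S (s (Suc 0))"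
      using S_ge[OF s_cont[of "Suc 0"] x(1)] by (simp add: s_Suc s_0)
    ultimately show ?case using x(2) by simp
  next
    case (Suc n)
    have "(1 + t) * e n \<le> 2 * e n"
      using t e_pos[of n] by simp
    also have "\<dots> = t ^ Suc n * (\<delta> / 2 ^ Suc (Suc n))"
      by (simp add: e_def power_add)
    finally have 1: "(1 + t) * e n \<le> t ^ Suc n * (\<delta> / 2 ^ Suc (Suc n))" .
    have "t * (t^n * (\<delta> / 2 + \<delta> / 2 ^ Suc n)) \<le> t * (S (s (Suc n)) - S (s n))"
      using Suc t by (intro mult_left_mono) auto
    with 1 step[of n] have
      "S (s (Suc (Suc n))) - S (s (Suc n)) \<ge> t * (t^n * (\<delta> / 2 + \<delta> / 2 ^ Suc n)) - t ^ Suc n * (\<delta> / 2 ^ Suc (Suc n))"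
      by linarith
    also have "t * (t^n * (\<delta> / 2 + \<delta> / 2 ^ Suc n)) - t ^ Suc n * (\<delta> / 2 ^ Suc (Suc n))
        = t ^ Suc n * (\<delta> / 2 + \<delta> / 2 ^ Suc (Suc n))"
      by (simp add: field_simps)
    finally show ?case .
  qed
  have gain: "S (s n) + t^n * (\<delta> / 2) \<le> S (s (Suc m))" if "n \<le> m" for n m
    using that
  proof (induction m rule: dec_induct)
    case base
    have "t^n * (\<delta> / 2) \<le> t^n * (\<delta> / 2 + \<delta> / 2 ^ Suc n)"
      using t \<open>\<delta> > 0\<close> by (intro mult_left_mono) auto
    then show ?case using incr[of n] by linarith
  next
    case (step m)
    have "0 \<le> t ^ Suc m * (\<delta> / 2 + \<delta> / 2 ^ Suc (Suc m))"
      using t \<open>\<delta> > 0\<close> by (intro mult_nonneg_nonneg) auto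
    then show ?case using incr[of "Suc m"] step.IH by linarith
  qed
  have tail: "s (Suc m) x \<le> s (Suc n) x + t ^ n * (\<delta> / 4)" if "n \<le> m" "x \<in> topspace X" for n m x
  proof -
    have "s (Suc m) x \<le> s (Suc n) x + (t ^ Suc n - t ^ Suc m) / (1 - t)"
      using that(1)
    proof (induction m rule: dec_induct)
      case (step m)
      have "s (Suc (Suc m)) x \<le> s (Suc m) x + t ^ Suc m"
        using y_bds[OF that(2), of "Suc m"] t by (simp add: s_Suc mult_left_le)
      also have "t ^ Suc m = (t ^ Suc m - t ^ Suc (Suc m)) / (1 - t)"
        using t by (simp add: field_simps)
      finally show ?case
        using step.IH by (simp add: diff_divide_distrib)
    qed simp
    also have "(t ^ Suc n - t ^ Suc m) / (1 - t) \<le> t ^ Suc n / (1 - t)"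
      using t by (intro divide_right_mono) auto
    also have "\<dots> = t ^ n * (t / (1 - t))"
      by simp
    also have "\<dots> = t ^ n * (\<delta> / 4)"
      unfolding t(3) ..
    finally show ?thesis by simp
  qed
  define F where "F n = {x \<in> topspace X. y n x \<in> {\<delta>/4..}}" for n
  have F_closed: "closedin X (F n)" for n
    unfolding F_def using H_cont[OF y_H]
    by (intro closedin_continuous_map_preimage[where Y = euclideanreal]) auto
  have fip: "\<Inter>\<F> \<noteq> {}" if fin: "finite \<F>" "\<F> \<subseteq> range F" for \<F>
  proof -
    obtain I where I: "finite I" "\<F> = F ` I"
      using finite_subset_image[OF fin] by blast
    obtain m where m: "\<And>n. n \<in> I \<Longrightarrow> n \<le> m"
      using Max_ge[OF I(1)] by blast
    obtain b where b: "b \<in> topspace X" "S (s (Suc m)) = s (Suc m) b"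
      using S_att[OF s_cont] by blast
    have "b \<in> F n" if "n \<le> m" for n
    proof -
      have "S (s n) + t^n * (\<delta> / 2) \<le> s (Suc n) b + t ^ n * (\<delta> / 4)"
        using gain[OF that] tail[OF that b(1)] b(2) by linarith
      moreover have "s n b \<le> S (s n)"
        by (rule S_ge[OF s_cont b(1)])
      ultimately have "t^n * (\<delta> / 4) \<le> t ^ n * y n b"
        by (simp add: s_Suc)
      then show ?thesis
        using t b(1) by (simp add: F_def)
    qed
    then have "b \<in> \<Inter>\<F>"
      unfolding I(2) using m by blast
    then show ?thesis by blast
  qed
  have "\<Inter>(range F) \<noteq> {}"
    using X[unfolded compact_space_fip, rule_format, of "range F"] F_closed fip by auto
  then obtain b where b: "\<And>n. y n b \<ge> \<delta>/4" "b \<in> topspace X"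
    by (auto simp: F_def)
  obtain n where n: "\<And>k. k \<ge> n \<Longrightarrow> w k b < \<delta>/8"
    using order_tendstoD(2)[OF null[OF b(2)], of "\<delta>/8"] \<open>\<delta> > 0\<close>
    by (auto simp: eventually_sequentially)
  have "y n b \<le> \<delta>/8"
  proof -
    have "0 \<le> y n b \<and> y n b \<le> \<delta>/8"
      using y_H[of n] unfolding H_def
      by (rule mixtures_bounds) (use n bds[OF b(2)] in \<open>auto intro: less_imp_le\<close>)
    then show ?thesis by simp
  qed
  then show False using b(1)[of n] \<open>\<delta> > 0\<close> by simp
qed

section \<open>Separable subspaces and functionals\<close>

text \<open>
Lists instead of finite subsets: concatenation is addition, and countability is that of lists.
\<close>
definition rat_span :: "'b::real_vector set \<Rightarrow> 'b set" where
  "rat_span S = (\<lambda>l. \<Sum>(q, s)\<leftarrow>l. of_rat q *\<^sub>R s) ` lists (UNIV \<times> S)"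

lemma countable_rat_span: "countable S \<Longrightarrow> countable (rat_span S)"
  unfolding rat_span_def by (intro countable_image countable_lists countable_SIGMA) auto

lemma rat_span_add:
  assumes "v \<in> rat_span S" "w \<in> rat_span S"
  shows "v + w \<in> rat_span S"
proof -
  obtain k l where "k \<in> lists (UNIV \<times> S)" "v = (\<Sum>(q, s)\<leftarrow>k. of_rat q *\<^sub>R s)"
    "l \<in> lists (UNIV \<times> S)" "w = (\<Sum>(q, s)\<leftarrow>l. of_rat q *\<^sub>R s)"
    using assms unfolding rat_span_def by blast
  then show ?thesis
    unfolding rat_span_def by (intro image_eqI[of _ _ "k @ l"]) auto
qed

lemma rat_span_scale:
  assumes "v \<in> rat_span S"
  shows "of_rat c *\<^sub>R v \<in> rat_span S"
proof -
  obtain k where k: "k \<in> lists (UNIV \<times> S)" "v = (\<Sum>(q, s)\<leftarrow>k. of_rat q *\<^sub>R s)"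
    using assms unfolding rat_span_def by blast
  have "of_rat c *\<^sub>R v = (\<Sum>(q, s)\<leftarrow>map (\<lambda>(q, s). (c * q, s)) k. of_rat q *\<^sub>R s)"
    unfolding k(2) by (induction k) (auto simp: scaleR_add_right of_rat_mult)
  moreover have "map (\<lambda>(q, s). (c * q, s)) k \<in> lists (UNIV \<times> S)"
    using k(1) by auto
  ultimately show ?thesis
    unfolding rat_span_def by blast
qed

lemma rat_span_base: "s \<in> S \<Longrightarrow> s \<in> rat_span S"
  unfolding rat_span_def by (intro image_eqI[of _ _ "[(1, s)]"]) auto

lemma rat_span_zero: "0 \<in> rat_span S"
  unfolding rat_span_def by (intro image_eqI[of _ _ "[]"]) auto

lemma rat_span_subset:
  assumes "subspace V" "S \<subseteq> V"
  shows "rat_span S \<subseteq> V"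
proof -
  have "(\<Sum>(q, s)\<leftarrow>l. of_rat q *\<^sub>R s) \<in> V" if "l \<in> lists (UNIV \<times> S)" for l :: "(rat \<times> 'a) list"
    using that by induction (use assms in \<open>auto simp: subspace_0 subspace_add subspace_scale\<close>)
  then show ?thesis
    unfolding rat_span_def by blast
qed

lemma subspace_closure_rat_span:
  fixes S :: "'b::real_normed_vector set"
  shows "subspace (closure (rat_span S))"
proof (rule subspaceI)
  show "0 \<in> closure (rat_span S)"
    using rat_span_zero closure_subset by blast
  show "x + y \<in> closure (rat_span S)" if xy: "x \<in> closure (rat_span S)" "y \<in> closure (rat_span S)" for x y
  proof -
    obtain f g where "\<And>n. f n \<in> rat_span S" "f \<longlonglongrightarrow> x" "\<And>n. g n \<in> rat_span S" "g \<longlonglongrightarrow> y"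
      using xy unfolding closure_sequential by blast
    then have "\<And>n. f n + g n \<in> rat_span S" "(\<lambda>n. f n + g n) \<longlonglongrightarrow> x + y"
      by (auto intro: rat_span_add tendsto_add)
    then show ?thesis
      unfolding closure_sequential by (intro exI[of _ "\<lambda>n. f n + g n"]) auto
  qed
  show "c *\<^sub>R x \<in> closure (rat_span S)" if x: "x \<in> closure (rat_span S)" for c x
  proof -
    obtain f where f: "\<And>n. f n \<in> rat_span S" "f \<longlonglongrightarrow> x"
      using x unfolding closure_sequential by blast
    have "\<exists>q. \<bar>of_rat q - c\<bar> < inverse (Suc n)" for n
    proof -
      obtain q where "c < of_rat q" "of_rat q < c + inverse (Suc n)"
        using of_rat_dense[of c "c + inverse (Suc n)"] by auto
      then have "\<bar>of_rat q - c\<bar> < inverse (Suc n)" by linarith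
      then show ?thesis ..
    qed
    then obtain q where q: "\<And>n. \<bar>of_rat (q n) - c\<bar> < inverse (Suc n)" by metis
    have "(\<lambda>n. of_rat (q n) - c) \<longlonglongrightarrow> 0"
      by (rule Lim_null_comparison[OF _ LIMSEQ_inverse_real_of_nat])
        (use q in \<open>auto intro!: always_eventually less_imp_le\<close>)
    then have "(\<lambda>n. of_rat (q n)) \<longlonglongrightarrow> c"
      by (simp add: LIM_zero_iff)
    then have "(\<lambda>n. of_rat (q n) *\<^sub>R f n) \<longlonglongrightarrow> c *\<^sub>R x"
      using f(2) by (intro tendsto_scaleR) auto
    moreover have "\<And>n. of_rat (q n) *\<^sub>R f n \<in> rat_span S"
      using f(1) by (rule rat_span_scale)
    ultimately show ?thesis
      unfolding closure_sequential by (intro exI[of _ "\<lambda>n. of_rat (q n) *\<^sub>R f n"]) auto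
  qed
qed

text \<open>
How the Asplund property is applied: countably many vectors of \<open>V\<close> lie in a separable closed
subspace, whose dual is then separable.
\<close>
lemma separable_banach_hull:
  assumes V: "banach_subspace V" and S: "countable S" "S \<subseteq> V"
  obtains W where "banach_subspace W" "S \<subseteq> W" "W \<subseteq> V" "separable_space (top_of_set W)"
proof
  let ?W = "closure (rat_span S)"
  show "banach_subspace ?W"
    by (simp add: banach_subspace_def subspace_closure_rat_span)
  show "S \<subseteq> ?W"
    using rat_span_base closure_subset by blast
  show "?W \<subseteq> V"
    using V S rat_span_subset[of V S] by (auto simp: banach_subspace_def intro: closure_minimal[THEN subsetD])
  show "separable_space (top_of_set ?W)"
    unfolding separable_space_def
    by (intro exI[of _ "rat_span S"] conjI countable_rat_span S)
      (auto simp: closure_subset closure_of_subtopology inf_absorb2)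
qed

lemma dual_scale: "f \<in> dual V \<Longrightarrow> v \<in> V \<Longrightarrow> f (c *\<^sub>R v) = c * f v"
  and dual_bounded: "f \<in> dual V \<Longrightarrow> \<exists>B. \<forall>v\<in>V. \<bar>f v\<bar> \<le> B * norm v"
  by (auto simp: dual_def)

lemma restrict_dual:
  assumes "f \<in> dual V" "W \<subseteq> V" "subspace W"
  shows "restrict f W \<in> dual W"
  using assms unfolding dual_def
  by (auto simp: subspace_add subspace_scale subset_iff) blast

text \<open>
The supremum that defines the dual norm is over a set bounded above, so it is an upper bound; this is
stated for differences of functionals because separability of the dual speaks about these.
\<close>
lemma dual_norm_bound:
  assumes W: "subspace W" and f: "f \<in> dual W" and d: "d \<in> dual W" and v: "v \<in> W"
  shows "\<bar>f v - d v\<bar> \<le> dual_norm W (\<lambda>v. f v - d v) * norm v"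
proof (cases "v = 0")
  case True
  then show ?thesis
    using dual_scale[OF f v, of 0] dual_scale[OF d v, of 0] by simp
next
  case False
  obtain B C where B: "\<And>v. v \<in> W \<Longrightarrow> \<bar>f v\<bar> \<le> B * norm v" and C: "\<And>v. v \<in> W \<Longrightarrow> \<bar>d v\<bar> \<le> C * norm v"
    using dual_bounded[OF f] dual_bounded[OF d] by blast
  have bdd: "bdd_above ((\<lambda>v. \<bar>f v - d v\<bar>) ` {v \<in> W. norm v \<le> 1})"
  proof (rule bdd_aboveI)
    fix r assume "r \<in> (\<lambda>v. \<bar>f v - d v\<bar>) ` {v \<in> W. norm v \<le> 1}"
    then obtain v where v: "v \<in> W" "norm v \<le> 1" "r = \<bar>f v - d v\<bar>" by auto
    have "r \<le> B * norm v + C * norm v"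
      using B[OF v(1)] C[OF v(1)] v(3) by linarith
    also have "\<dots> \<le> \<bar>B\<bar> * 1 + \<bar>C\<bar> * 1"
      using v(2) by (intro add_mono mult_mono) auto
    finally show "r \<le> \<bar>B\<bar> * 1 + \<bar>C\<bar> * 1" .
  qed
  let ?u = "inverse (norm v) *\<^sub>R v"
  have u: "?u \<in> {v \<in> W. norm v \<le> 1}"
    using False v W by (simp add: subspace_scale)
  have "\<bar>f v - d v\<bar> = \<bar>f ?u - d ?u\<bar> * norm v"
    using False v dual_scale[OF f v, of "inverse (norm v)"] dual_scale[OF d v, of "inverse (norm v)"]
    by (simp add: abs_mult flip: right_diff_distrib)
  also have "\<dots> \<le> dual_norm W (\<lambda>v. f v - d v) * norm v"
    unfolding dual_norm_def using cSUP_upper[OF u bdd] by (intro mult_right_mono) auto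
  finally show ?thesis .
qed

section \<open>Norm continuity in the dual of an Asplund space\<close>

text \<open>
A weak-star continuous map into the dual of an Asplund space is norm continuous at the points of a
dense \<open>G\<^sub>\<delta>\<close>. Let \<open>O' e\<close> be the union of the open sets whose image has norm diameter at
most \<open>e\<close>. For each basic open set with larger image one vector witnesses this; these countably
many witnesses span a separable \<open>W\<close>. A countable dense subset of the dual of \<open>W\<close> covers the space
by closed sets on which the image, restricted to \<open>W\<close>, has diameter below \<open>e\<close>. Off
\<open>O' e\<close> such a closed set has empty interior, since a basic open set inside it would contradict
its own witness. So \<open>O' e\<close> is dense by Baire's theorem.
\<close>
theorem asplund_norm_continuity_points:
  fixes V :: "'b::banach set" and \<alpha> :: "'z \<Rightarrow> 'b \<Rightarrow> real"
  assumes V: "asplund V"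
    and sc: "second_countable Z"
    and Z: "completely_metrizable_space Z"
    and \<alpha>: "\<And>z. z \<in> topspace Z \<Longrightarrow> \<alpha> z \<in> dual V"
    and cont: "\<And>v. v \<in> V \<Longrightarrow> continuous_map Z euclideanreal (\<lambda>z. \<alpha> z v)"
  obtains Z\<^sub>0 where "gdelta_in Z Z\<^sub>0" "Z closure_of Z\<^sub>0 = topspace Z"
    "\<And>z e. z \<in> Z\<^sub>0 \<Longrightarrow> e > 0 \<Longrightarrow> \<exists>U. openin Z U \<and> z \<in> U \<and> (\<forall>y\<in>U. \<forall>v\<in>V. \<bar>\<alpha> y v - \<alpha> z v\<bar> \<le> e * norm v)"
proof -
  define small where "small e U \<longleftrightarrow> (\<forall>y\<in>U. \<forall>z\<in>U. \<forall>v\<in>V. \<bar>\<alpha> y v - \<alpha> z v\<bar> \<le> e * norm v)" for e U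
  define O' where "O' e = \<Union>{U. openin Z U \<and> small e U}" for e
  have O_open: "openin Z (O' e)" for e
    unfolding O'_def by (intro openin_Union) auto
  obtain \<B> where \<B>: "countable \<B>" "\<And>B. B \<in> \<B> \<Longrightarrow> openin Z B"
    "\<And>U x. openin Z U \<Longrightarrow> x \<in> U \<Longrightarrow> \<exists>B\<in>\<B>. x \<in> B \<and> B \<subseteq> U"
    using sc by (auto simp: second_countable_def)
  have bV: "banach_subspace V"
    using V by (simp add: asplund_def)
  have O_dense: "Z closure_of (O' e) = topspace Z" if e: "e > 0" for e
  proof -
    define \<B>' where "\<B>' = {B \<in> \<B>. \<not> small e B}"
    have "\<exists>v. v \<in> V \<and> (\<exists>y\<in>B. \<exists>z\<in>B. \<bar>\<alpha> y v - \<alpha> z v\<bar> > e * norm v)" if "B \<in> \<B>'" for B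
      using that by (auto simp: \<B>'_def small_def not_le)
    then obtain v where v: "\<And>B. B \<in> \<B>' \<Longrightarrow> v B \<in> V"
      "\<And>B. B \<in> \<B>' \<Longrightarrow> \<exists>y\<in>B. \<exists>z\<in>B. \<bar>\<alpha> y (v B) - \<alpha> z (v B)\<bar> > e * norm (v B)"
      by metis
    have "countable (v ` \<B>')" "v ` \<B>' \<subseteq> V"
      using \<B>(1) v(1) by (auto simp: \<B>'_def)
    then obtain W where W: "banach_subspace W" "v ` \<B>' \<subseteq> W" "W \<subseteq> V" "separable_space (top_of_set W)"
      using separable_banach_hull[OF bV] by blast
    then have "separable_dual W"
      using V by (simp add: asplund_def)
    then obtain D where D: "countable D" "D \<subseteq> dual W"
      "\<And>f e. f \<in> dual W \<Longrightarrow> e > 0 \<Longrightarrow> \<exists>d\<in>D. dual_norm W (\<lambda>v. f v - d v) < e"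
      unfolding separable_dual_def by blast
    have sW: "subspace W"
      using W(1) by (simp add: banach_subspace_def)
    define T where "T d = {y \<in> topspace Z. \<forall>v\<in>W. \<bar>\<alpha> y v - d v\<bar> \<le> e / 3 * norm v}" for d
    have T_closed: "closedin Z (T d)" for d
    proof -
      have "closedin Z {y \<in> topspace Z. \<alpha> y v \<in> cball (d v) (e / 3 * norm v)}" if "v \<in> W" for v
        using cont[of v] that W(3) by (intro closedin_continuous_map_preimage) auto
      moreover have "T d = (\<Inter>v\<in>W. {y \<in> topspace Z. \<alpha> y v \<in> cball (d v) (e / 3 * norm v)})"
        using subspace_0[OF sW] by (auto simp: T_def dist_real_def abs_minus_commute)
      ultimately show ?thesis
        using subspace_0[OF sW] by (metis (no_types, lifting) closedin_INT empty_iff)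
    qed
    have T_cover: "\<exists>d\<in>D. y \<in> T d" if y: "y \<in> topspace Z" for y
    proof -
      let ?f = "restrict (\<alpha> y) W"
      have f: "?f \<in> dual W"
        using restrict_dual[OF \<alpha>[OF y] W(3) sW] .
      obtain d where d: "d \<in> D" "dual_norm W (\<lambda>v. ?f v - d v) < e / 3"
        using D(3)[OF f, of "e/3"] e by auto
      have "\<bar>\<alpha> y v - d v\<bar> \<le> e / 3 * norm v" if "v \<in> W" for v
      proof -
        have "\<bar>?f v - d v\<bar> \<le> dual_norm W (\<lambda>v. ?f v - d v) * norm v"
          using d(1) D(2) by (intro dual_norm_bound sW f that) auto
        also have "\<dots> \<le> e / 3 * norm v"
          using d(2) by (intro mult_right_mono) auto
        finally show ?thesis using that by simp
      qed
      then show ?thesis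
        using d(1) y by (auto simp: T_def)
    qed
    have F_int: "Z interior_of (T d - O' e) = {}" for d
    proof (rule ccontr)
      assume "Z interior_of (T d - O' e) \<noteq> {}"
      then obtain x where "x \<in> Z interior_of (T d - O' e)" by blast
      then obtain B where B: "B \<in> \<B>" "x \<in> B" "B \<subseteq> Z interior_of (T d - O' e)"
        using \<B>(3)[OF openin_interior_of] by blast
      then have BT: "B \<subseteq> T d - O' e"
        using interior_of_subset by fast
      have "\<not> small e B"
        using BT B \<B>(2)[OF B(1)] unfolding O'_def by blast
      then have B': "B \<in> \<B>'"
        using B(1) by (simp add: \<B>'_def)
      obtain y z where yz: "y \<in> B" "z \<in> B" "\<bar>\<alpha> y (v B) - \<alpha> z (v B)\<bar> > e * norm (v B)"
        using v(2)[OF B'] by blast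
      have "v B \<in> W"
        using W(2) B' by auto
      then have "\<bar>\<alpha> y (v B) - d (v B)\<bar> \<le> e / 3 * norm (v B)" "\<bar>\<alpha> z (v B) - d (v B)\<bar> \<le> e / 3 * norm (v B)"
        using yz(1,2) BT by (auto simp: T_def)
      moreover have "0 \<le> e / 3 * norm (v B)" using e by simp
      ultimately show False
        using yz(3) by linarith
    qed
    have "Z interior_of \<Union>((\<lambda>d. T d - O' e) ` D) = {}"
    proof (rule Baire_category_alt)
      fix F assume "F \<in> (\<lambda>d. T d - O' e) ` D"
      then obtain d where "F = T d - O' e" by blast
      then show "closedin Z F \<and> Z interior_of F = {}"
        using F_int[of d] T_closed[of d] O_open[of e] by (simp add: closedin_diff)
    qed (use Z D(1) in auto)
    moreover have "\<Union>((\<lambda>d. T d - O' e) ` D) = topspace Z - O' e"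
      using T_cover by (auto simp: T_def)
    ultimately show ?thesis
      by (simp add: closure_of_interior_of)
  qed
  define Z\<^sub>0 where "Z\<^sub>0 = \<Inter>(range (\<lambda>n. O' (inverse (Suc n))))"
  show ?thesis
  proof
    show "gdelta_in Z Z\<^sub>0"
      unfolding Z\<^sub>0_def by (intro gdelta_in_Inter) (auto intro: open_imp_gdelta_in O_open)
    show "Z closure_of Z\<^sub>0 = topspace Z"
      unfolding Z\<^sub>0_def
    proof (rule Baire_category)
      fix T assume "T \<in> range (\<lambda>n. O' (inverse (Suc n)))"
      then obtain n where "T = O' (inverse (Suc n))" by blast
      then show "openin Z T \<and> Z closure_of T = topspace Z"
        using O_open O_dense[of "inverse (Suc n)"] by simp
    qed (use Z in auto)
    fix z and e :: real assume z: "z \<in> Z\<^sub>0" and "e > 0"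
    then obtain n where n: "inverse (Suc n) < e"
      using reals_Archimedean by blast
    have "z \<in> O' (inverse (Suc n))"
      using z unfolding Z\<^sub>0_def by blast
    then obtain U where U: "openin Z U" "small (inverse (Suc n)) U" "z \<in> U"
      unfolding O'_def by blast
    have "\<bar>\<alpha> y v - \<alpha> z v\<bar> \<le> e * norm v" if "y \<in> U" "v \<in> V" for y v
    proof -
      have "\<bar>\<alpha> y v - \<alpha> z v\<bar> \<le> inverse (Suc n) * norm v"
        using U that unfolding small_def by blast
      also have "\<dots> \<le> e * norm v"
        using n by (intro mult_right_mono) auto
      finally show ?thesis .
    qed
    then show "\<exists>U. openin Z U \<and> z \<in> U \<and> (\<forall>y\<in>U. \<forall>v\<in>V. \<bar>\<alpha> y v - \<alpha> z v\<bar> \<le> e * norm v)"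
      using U by blast
  qed
qed

section \<open>From representations to generic continuity\<close>

lemma continuous_map_realI:
  fixes f :: "'x \<Rightarrow> real"
  assumes "\<And>x e. x \<in> topspace X \<Longrightarrow> e > 0 \<Longrightarrow> \<exists>U. openin X U \<and> x \<in> U \<and> (\<forall>y\<in>U. \<bar>f y - f x\<bar> < e)"
  shows "continuous_map X euclideanreal f"
  using assms Met_TC.continuous_map_to_metric[of X f]
  by (simp add: dist_real_def abs_minus_commute)

text \<open>
The enveloping semigroup is a closure, so it suffices to verify a closed condition for the translations.
\<close>
lemma enveloping_semigroup_extends:
  assumes "p \<in> enveloping_semigroup X act"
    and "closedin (product_topology (\<lambda>_. X) (topspace X)) C"
    and "\<And>g. restrict (act g) (topspace X) \<in> C"
  shows "p \<in> C"
  using closure_of_minimal[OF _ assms(2), of "range (\<lambda>g. restrict (act g) (topspace X))"] assms(1,3)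
  by (auto simp: enveloping_semigroup_def)

lemma enveloping_semigroup_maps_to:
  assumes "p \<in> enveloping_semigroup X act" "x \<in> topspace X"
  shows "p x \<in> topspace X"
proof -
  have "p \<in> topspace (product_topology (\<lambda>_. X) (topspace X))"
    using assms(1) closure_of_subset_topspace unfolding enveloping_semigroup_def by fastforce
  then show ?thesis
    using assms(2) by auto
qed


text \<open>
At a point of norm continuity of \<open>\<alpha>\<close> the estimate
\<open>\<bar>\<alpha> y u - \<alpha> z u\<bar> \<le> c * norm u\<close> holds for all \<open>u\<close> at once, in particular for
\<open>u = h g v\<close>, whose norm is that of \<open>v\<close>. Hence \<open>\<bar>\<alpha> (g y) v - \<alpha> (g z) v\<bar> \<le> c * norm v\<close> on one
neighbourhood that serves every \<open>g\<close>. This is a closed condition on the translation, so it passes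
to every \<open>p\<close> in the enveloping semigroup.
\<close>
theorem RN_over_imp_generic_continuity:
  fixes X :: "'x topology" and act :: "'g::topological_group_add \<Rightarrow> 'x \<Rightarrow> 'x"
  assumes sys: "compact_metric_system X act"
    and RN: "RN_over TYPE('b::banach) X act"
    and Y: "closedin X Y"
  shows "generic_continuity X act Y"
proof -
  have cX: "compact_space X" and mX: "metrizable_space X"
    using sys by (auto simp: compact_metric_system_def)
  obtain V :: "'b set" and h \<alpha> where V: "asplund V"
    and h: "strongly_continuous_cohom V h"
    and emb: "embedding_map X (weak_star V) \<alpha>"
    and equi: "\<And>g x. x \<in> topspace X \<Longrightarrow> \<alpha> (act g x) = dual_action V h g (\<alpha> x)"
    using RN unfolding RN_over_def by blast
  have YX: "Y \<subseteq> topspace X"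
    using Y by (rule closedin_subset)
  define Z where "Z = subtopology X Y"
  have tZ: "topspace Z = Y"
    using YX by (auto simp: Z_def)
  have hom: "homeomorphic_map X (subtopology (weak_star V) (\<alpha> ` topspace X)) \<alpha>"
    using emb by (simp add: embedding_map_def)
  have \<alpha>_cont: "continuous_map X (weak_star V) \<alpha>"
    using homeomorphic_imp_continuous_map[OF hom] by (simp add: continuous_map_in_subtopology)
  have \<alpha>_dual: "\<alpha> x \<in> dual V" if "x \<in> topspace X" for x
    using \<alpha>_cont that by (auto simp: weak_star_def continuous_map_in_subtopology)
  have \<alpha>_eval: "continuous_map X euclideanreal (\<lambda>x. \<alpha> x v)" if "v \<in> V" for v
    using \<alpha>_cont that
    by (auto simp: weak_star_def continuous_map_in_subtopology continuous_map_componentwise)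
  obtain \<beta> where \<beta>: "homeomorphic_maps X (subtopology (weak_star V) (\<alpha> ` topspace X)) \<alpha> \<beta>"
    using hom homeomorphic_map_maps by blast
  have "completely_metrizable_space X"
    using cX mX by (simp add: compact_imp_locally_compact_space locally_compact_imp_completely_metrizable_space)
  then have Z_cm: "completely_metrizable_space Z"
    using Y unfolding Z_def by (rule completely_metrizable_space_closedin)
  have Z_sc: "second_countable Z"
    unfolding Z_def by (intro second_countable_subtopology compact_metrizable_imp_second_countable cX mX)
  obtain Z\<^sub>0 where Z0: "gdelta_in Z Z\<^sub>0" "Z closure_of Z\<^sub>0 = topspace Z"
    and pt: "\<And>z e. z \<in> Z\<^sub>0 \<Longrightarrow> e > 0 \<Longrightarrow>
      \<exists>U. openin Z U \<and> z \<in> U \<and> (\<forall>y\<in>U. \<forall>v\<in>V. \<bar>\<alpha> y v - \<alpha> z v\<bar> \<le> e * norm v)"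
  proof (rule asplund_norm_continuity_points[OF V Z_sc Z_cm, of \<alpha>])
    show "\<alpha> z \<in> dual V" if "z \<in> topspace Z" for z
      using that \<alpha>_dual YX tZ by auto
    show "continuous_map Z euclideanreal (\<lambda>z. \<alpha> z v)" if "v \<in> V" for v
      unfolding Z_def using \<alpha>_eval[OF that] by (rule continuous_map_from_subtopology)
  qed blast
  have Z0Y: "Z\<^sub>0 \<subseteq> Y"
    using gdelta_in_subset[OF Z0(1)] tZ by simp
  have h_V: "h g v \<in> V" "norm (h g v) = norm v" if "v \<in> V" for g v
  proof -
    have "h g \<in> Iso V"
      using h by (simp add: strongly_continuous_cohom_def)
    then have "bij_betw (h g) V V" "norm (h g v) = norm v"
      using that unfolding Iso_def by blast+
    then show "h g v \<in> V" "norm (h g v) = norm v"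
      using that by (auto simp: bij_betw_def)
  qed
  have p_cont: "continuous_map (subtopology X Z\<^sub>0) X p" if p: "p \<in> enveloping_semigroup X act" for p
  proof -
    have p_X: "p x \<in> topspace X" if "x \<in> topspace X" for x
      by (rule enveloping_semigroup_maps_to[OF p that])
    have tZ0: "topspace (subtopology X Z\<^sub>0) = Z\<^sub>0"
      using Z0Y YX by auto
    have eval: "continuous_map (subtopology X Z\<^sub>0) euclideanreal (\<lambda>y. \<alpha> (p y) v)" if v: "v \<in> V" for v
    proof (rule continuous_map_realI)
      fix z and e :: real assume "z \<in> topspace (subtopology X Z\<^sub>0)" and e: "e > 0"
      then have z: "z \<in> Z\<^sub>0" using tZ0 by simp
      define c where "c = e / (norm v + 1)"
      have k: "norm v + 1 > 0"
        using norm_ge_zero[of v] by linarith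
      have c: "c > 0"
        using e k by (simp add: c_def)
      have "c * norm v = e * norm v / (norm v + 1)"
        by (simp add: c_def)
      also have "\<dots> < e"
        using k e by (simp add: pos_divide_less_eq algebra_simps)
      finally have ce: "c * norm v < e" .
      obtain U where U: "openin Z U" "z \<in> U" and U': "\<forall>y\<in>U. \<forall>u\<in>V. \<bar>\<alpha> y u - \<alpha> z u\<bar> \<le> c * norm u"
        using pt[OF z c] by blast
      have bound: "\<bar>\<alpha> (p y) v - \<alpha> (p z) v\<bar> \<le> c * norm v" if y: "y \<in> U" for y
      proof -
        let ?P = "product_topology (\<lambda>_. X) (topspace X)"
        have "U \<subseteq> Y"
          using openin_subset[OF U(1)] tZ by simp
        then have yX: "y \<in> topspace X" and zX: "z \<in> topspace X"
          using y z YX Z0Y by blast+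
        define C where "C = {q \<in> topspace ?P. \<alpha> (q y) v - \<alpha> (q z) v \<in> cball 0 (c * norm v)}"
        have "continuous_map ?P euclideanreal (\<lambda>q. \<alpha> (q x) v)" if "x \<in> topspace X" for x
          using continuous_map_compose[OF continuous_map_product_projection[OF that] \<alpha>_eval[OF v]]
          by (simp add: o_def)
        then have "closedin ?P C"
          unfolding C_def using yX zX
          by (intro closedin_continuous_map_preimage[where Y = euclideanreal] continuous_map_diff) auto
        moreover have "restrict (act g) (topspace X) \<in> C" for g
        proof -
          have "act g x \<in> topspace X" if "x \<in> topspace X" for x
            using sys that by (force simp: compact_metric_system_def continuous_map_def)
          moreover have "\<alpha> (act g y) v - \<alpha> (act g z) v = \<alpha> y (h g v) - \<alpha> z (h g v)"
            using equi yX zX v by (simp add: dual_action_def)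
          moreover have "\<bar>\<alpha> y (h g v) - \<alpha> z (h g v)\<bar> \<le> c * norm v"
            using bspec[OF bspec[OF U' y] h_V(1)[OF v, of g]] h_V(2)[OF v] by simp
          ultimately show ?thesis
            using yX zX by (auto simp: C_def)
        qed
        ultimately have "p \<in> C"
          by (rule enveloping_semigroup_extends[OF p])
        then show ?thesis
          by (simp add: C_def)
      qed
      obtain O' where O': "openin X O'" "U = O' \<inter> Y"
        using U(1) by (auto simp: Z_def openin_subtopology)
      have "openin (subtopology X Z\<^sub>0) (O' \<inter> Z\<^sub>0)" "z \<in> O' \<inter> Z\<^sub>0"
        using O' U(2) z by (auto simp: openin_subtopology)
      moreover have "\<forall>y\<in>O' \<inter> Z\<^sub>0. \<bar>\<alpha> (p y) v - \<alpha> (p z) v\<bar> < e"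
      proof
        fix y assume "y \<in> O' \<inter> Z\<^sub>0"
        then have "y \<in> U" using O'(2) Z0Y by blast
        then show "\<bar>\<alpha> (p y) v - \<alpha> (p z) v\<bar> < e"
          using bound ce by fastforce
      qed
      ultimately show "\<exists>U. openin (subtopology X Z\<^sub>0) U \<and> z \<in> U \<and> (\<forall>y\<in>U. \<bar>\<alpha> (p y) v - \<alpha> (p z) v\<bar> < e)"
        by blast
    qed
    have "continuous_map (subtopology X Z\<^sub>0) (product_topology (\<lambda>_. euclideanreal) V) (\<lambda>y. \<alpha> (p y))"
      unfolding continuous_map_componentwise
    proof (intro conjI ballI)
      show "(\<lambda>y. \<alpha> (p y)) ` topspace (subtopology X Z\<^sub>0) \<subseteq> extensional V"
        using \<alpha>_dual p_X by (auto simp: dual_def)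
    qed (use eval in auto)
    then have "continuous_map (subtopology X Z\<^sub>0) (subtopology (weak_star V) (\<alpha> ` topspace X)) (\<lambda>y. \<alpha> (p y))"
      using \<alpha>_dual p_X by (auto simp: weak_star_def continuous_map_in_subtopology)
    moreover have "continuous_map (subtopology (weak_star V) (\<alpha> ` topspace X)) X \<beta>"
      using \<beta> by (simp add: homeomorphic_maps_def)
    ultimately have "continuous_map (subtopology X Z\<^sub>0) X (\<beta> \<circ> (\<lambda>y. \<alpha> (p y)))"
      by (rule continuous_map_compose)
    then show ?thesis
      by (rule continuous_map_eq) (use \<beta> p_X in \<open>auto simp: homeomorphic_maps_def\<close>)
  qed
  show ?thesis
    unfolding generic_continuity_def
    using Z0 tZ p_cont unfolding Z_def by blast
qed

section \<open>The orbit metric of a compact metric system\<close>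

locale compact_metric_action = Metric_space M d
  for M :: "'x set" and d :: "'x \<Rightarrow> 'x \<Rightarrow> real" +
  fixes act :: "'g::topological_group_add \<Rightarrow> 'x \<Rightarrow> 'x"
  assumes system: "compact_metric_system mtopology act"
begin

lemma compact_M: "compact_space mtopology"
  and act_continuous: "continuous_map (prod_topology euclidean mtopology) mtopology (\<lambda>(g, x). act g x)"
  and act_zero: "x \<in> M \<Longrightarrow> act 0 x = x"
  and act_add: "x \<in> M \<Longrightarrow> act (g + g') x = act g (act g' x)"
  using system by (auto simp: compact_metric_system_def)

lemma act_in: "x \<in> M \<Longrightarrow> act g x \<in> M"
  using act_continuous by (force simp: continuous_map_def)

lemma act_minus: "x \<in> M \<Longrightarrow> act (- g) (act g x) = x" "x \<in> M \<Longrightarrow> act g (act (- g) x) = x"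
  by (simp_all add: act_zero flip: act_add)

lemma continuous_map_act: "continuous_map mtopology mtopology (act g)"
proof -
  have "continuous_map mtopology (prod_topology euclidean mtopology) (\<lambda>x. (g, x))"
    by (intro continuous_map_pairedI) auto
  from continuous_map_compose[OF this act_continuous] show ?thesis
    by (simp add: o_def)
qed

lemma second_countable_M: "second_countable mtopology"
  using compact_M metrizable_space_mtopology by (rule compact_metrizable_imp_second_countable)

text \<open>
The largest metric between the orbits; it is invariant, and its topology is in general finer than the
given one. Separability of this metric is what links the two conditions.
\<close>
definition orbit_dist :: "'x \<Rightarrow> 'x \<Rightarrow> real" where
  "orbit_dist x y = (SUP g. d (act g x) (act g y))"

lemma bounded_dist: "\<exists>B. \<forall>x\<in>M. \<forall>y\<in>M. d x y \<le> B"
  using compact_M compact_space_eq_mcomplete_mtotally_bounded mtotally_bounded_imp_mbounded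
  unfolding mbounded_alt by blast

lemma dist_le_orbit_dist:
  assumes "x \<in> M" "y \<in> M"
  shows "d (act g x) (act g y) \<le> orbit_dist x y"
proof -
  obtain B where "\<And>x y. x \<in> M \<Longrightarrow> y \<in> M \<Longrightarrow> d x y \<le> B"
    using bounded_dist by blast
  then have "bdd_above (range (\<lambda>g. d (act g x) (act g y)))"
    using assms by (intro bdd_aboveI[of _ B]) (auto intro: act_in)
  then show ?thesis
    unfolding orbit_dist_def by (intro cSUP_upper) auto
qed

lemma orbit_dist_le:
  assumes "\<And>g. d (act g x) (act g y) \<le> c"
  shows "orbit_dist x y \<le> c"
  unfolding orbit_dist_def using assms by (intro cSUP_least) auto

lemma orbit_dist_nonneg: "x \<in> M \<Longrightarrow> y \<in> M \<Longrightarrow> 0 \<le> orbit_dist x y"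
  using dist_le_orbit_dist[of x y 0] by (simp add: act_zero order_trans[OF nonneg])

lemma orbit_dist_commute: "orbit_dist x y = orbit_dist y x"
  by (simp add: orbit_dist_def commute)

lemma orbit_dist_triangle:
  assumes "x \<in> M" "y \<in> M" "z \<in> M"
  shows "orbit_dist x z \<le> orbit_dist x y + orbit_dist y z"
proof (rule orbit_dist_le)
  fix g
  have "d (act g x) (act g z) \<le> d (act g x) (act g y) + d (act g y) (act g z)"
    using assms by (intro triangle act_in)
  also have "\<dots> \<le> orbit_dist x y + orbit_dist y z"
    using assms by (intro add_mono dist_le_orbit_dist)
  finally show "d (act g x) (act g z) \<le> orbit_dist x y + orbit_dist y z" .
qed

lemma orbit_dist_act_le:
  assumes "x \<in> M" "y \<in> M"
  shows "orbit_dist (act g x) (act g y) \<le> orbit_dist x y"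
  using assms dist_le_orbit_dist[OF assms] by (intro orbit_dist_le) (simp flip: act_add)

lemma orbit_dist_act:
  assumes "x \<in> M" "y \<in> M"
  shows "orbit_dist (act g x) (act g y) = orbit_dist x y"
  using orbit_dist_act_le[OF assms, of g] orbit_dist_act_le[OF act_in act_in, OF assms, of "- g" g g]
  by (simp add: act_minus assms)

text \<open>
The one place where generic continuity is used. Evaluation \<open>(p, y) \<mapsto> p y\<close> on
\<open>E \<times> Y\<^sub>0\<close> is separately continuous with \<open>E\<close> compact, and the conclusion is joint continuity in the
manner of Namioka. Since each \<open>p\<close> is determined on \<open>Y\<^sub>0\<close> by its restriction to a countable dense set
\<open>D\<close>, the sets \<open>{p. p|D \<in> B}\<close> with \<open>B\<close> from a countable base of \<open>X^D\<close> are fine enough to make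
\<open>p \<mapsto> p y\<close> almost constant. So for each \<open>y\<close> there are finitely many pairs \<open>(B, c)\<close> such
that the \<open>B\<close> cover \<open>E\<close> and \<open>p y\<close> is near \<open>c\<close> whenever \<open>p|D \<in> B\<close>. There are only
countably many such finite families, the set of \<open>y\<close> that fit a given family is closed in \<open>Y\<^sub>0\<close>, and
Baire's theorem gives a family that fits all \<open>y\<close> of a nonempty open set.
\<close>
lemma generic_continuity_imp_small_open_set:
  assumes Y: "closedin mtopology Y" "Y \<noteq> {}" and gen: "generic_continuity mtopology act Y" and "e > 0"
  obtains U where "openin mtopology U" "U \<inter> Y \<noteq> {}"
    "\<And>x y. x \<in> U \<inter> Y \<Longrightarrow> y \<in> U \<inter> Y \<Longrightarrow> orbit_dist x y \<le> e"
proof -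
  let ?E = "enveloping_semigroup mtopology act"
  let ?P = "product_topology (\<lambda>_. mtopology) M"
  have YM: "Y \<subseteq> M"
    using closedin_subset[OF Y(1)] by simp
  obtain Y\<^sub>0 where Y0: "gdelta_in (subtopology mtopology Y) Y\<^sub>0" "subtopology mtopology Y closure_of Y\<^sub>0 = Y"
    and p_cont: "\<And>p. p \<in> ?E \<Longrightarrow> continuous_map (subtopology mtopology Y\<^sub>0) mtopology p"
    using gen unfolding generic_continuity_def by blast
  have Y0Y: "Y\<^sub>0 \<subseteq> Y" using gdelta_in_subset[OF Y0(1)] by simp
  have Y0M: "Y\<^sub>0 \<subseteq> M" using Y0Y YM by blast
  have "Y\<^sub>0 \<noteq> {}" using Y0(2) Y(2) by auto
  define Z where "Z = subtopology mtopology Y\<^sub>0"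
  have tZ: "topspace Z = Y\<^sub>0" using Y0M by (auto simp: Z_def)
  have "completely_metrizable_space mtopology"
    by (simp add: compact_M metrizable_space_mtopology compact_imp_locally_compact_space
        locally_compact_imp_completely_metrizable_space)
  then have "completely_metrizable_space (subtopology mtopology Y)"
    using Y(1) by (rule completely_metrizable_space_closedin)
  then have "completely_metrizable_space (subtopology (subtopology mtopology Y) Y\<^sub>0)"
    using Y0(1) by (rule completely_metrizable_space_gdelta_in)
  then have Z_cm: "completely_metrizable_space Z"
    using Y0Y by (simp add: Z_def subtopology_subtopology inf_absorb2)
  have "separable_space Z"
    unfolding Z_def by (intro second_countable_imp_separable_space second_countable_subtopology second_countable_M)
  then obtain D where D: "countable D" "D \<subseteq> Y\<^sub>0" "Z closure_of D = Y\<^sub>0"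
    unfolding separable_space_def tZ by blast
  obtain Q where Q: "countable Q" "Q \<subseteq> M" "mtopology closure_of Q = M"
    using second_countable_imp_separable_space[OF second_countable_M]
    unfolding separable_space_def topspace_mtopology by blast
  have P_compact: "compact_space ?P" 
    using compact_M by (simp add: compact_space_product_topology)
  have E_closed: "closedin ?P ?E"
    by (simp add: enveloping_semigroup_def)
  have E_compact: "compactin ?P ?E"
    using P_compact E_closed by (rule closedin_compact_space)
  have p_M: "p x \<in> M" if "p \<in> ?E" "x \<in> M" for p x
    using enveloping_semigroup_maps_to[OF that(1)] that(2) by simp
  define P' where "P' = product_topology (\<lambda>_. mtopology) D"
  have P'_compact: "compact_space P'" 
    using compact_M by (simp add: P'_def compact_space_product_topology)
  have P'_metrizable: "metrizable_space P'"
    using D(1) metrizable_space_mtopology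
    by (auto simp: P'_def metrizable_space_product_topology intro: countable_subset)
  obtain \<B> where \<B>: "countable \<B>" "\<And>B. B \<in> \<B> \<Longrightarrow> openin P' B"
    "\<And>U x. openin P' U \<Longrightarrow> x \<in> U \<Longrightarrow> \<exists>B\<in>\<B>. x \<in> B \<and> B \<subseteq> U"
    using compact_metrizable_imp_second_countable[OF P'_compact P'_metrizable]
    by (auto simp: second_countable_def)
  define r where "r p = restrict p D" for p :: "'x \<Rightarrow> 'x"
  have DM: "D \<subseteq> M" using D(2) Y0M by blast
  have r_cont: "continuous_map ?P P' r"
    unfolding P'_def continuous_map_componentwise
  proof (intro conjI ballI)
    fix k assume k: "k \<in> D"
    have "continuous_map ?P mtopology (\<lambda>p. p k)"
      using k DM by (intro continuous_map_product_projection) auto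
    then show "continuous_map ?P mtopology (\<lambda>p. r p k)"
      using k by (simp add: r_def)
  qed (auto simp: r_def)
  have r_inj: "p y = q y" if "p \<in> ?E" "q \<in> ?E" "r p = r q" "y \<in> Y\<^sub>0" for p q y
  proof -
    have eq: "p k = q k" if "k \<in> D" for k
      using \<open>r p = r q\<close> that unfolding r_def by (metis restrict_apply')
    show ?thesis
      using forall_in_closure_of_eq[of y Z D mtopology p q] p_cont[OF that(1)] p_cont[OF that(2)] 
        Hausdorff_space_mtopology D(3) that(4) eq by (auto simp: Z_def)
  qed
  define \<epsilon> where "\<epsilon> = e / 6"
  have \<epsilon>: "\<epsilon> > 0" using \<open>e > 0\<close> by (simp add: \<epsilon>_def)
  have local: "\<exists>B c. B \<in> \<B> \<and> c \<in> Q \<and> r p\<^sub>0 \<in> B \<and> (\<forall>p\<in>?E. r p \<in> B \<longrightarrow> p y \<in> mcball c (2 * \<epsilon>))"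
    if y: "y \<in> Y\<^sub>0" and p0: "p\<^sub>0 \<in> ?E" for y p\<^sub>0
  proof -
    have yM: "y \<in> M" using y Y0M by blast
    have p0y: "p\<^sub>0 y \<in> M" by (rule p_M[OF p0 yM])
    \<comment> \<open>The maps in \<open>E\<close> that move \<open>y\<close> away from \<open>p\<^sub>0 y\<close>; their restrictions to \<open>D\<close> form a closed set that misses \<open>p\<^sub>0|D\<close>.\<close>
    define C where "C = ?E \<inter> {p \<in> topspace ?P. p y \<in> M - mball (p\<^sub>0 y) \<epsilon>}"
    have "closedin ?P C"
      unfolding C_def
    proof (intro closedin_Int E_closed closedin_continuous_map_preimage)
      show "continuous_map ?P mtopology (\<lambda>p. p y)"
        using yM by (intro continuous_map_product_projection) auto
      show "closedin mtopology (M - mball (p\<^sub>0 y) \<epsilon>)"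
        using closedin_diff[OF closedin_topspace openin_mball] by simp
    qed
    then have "compactin P' (r ` C)"
      using r_cont P_compact by (meson closedin_compact_space image_compactin)
    then have "closedin P' (r ` C)"
      using metrizable_imp_Hausdorff_space[OF P'_metrizable] by (intro compactin_imp_closedin)
    then have op: "openin P' (topspace P' - r ` C)"
      by (rule openin_diff[OF openin_topspace])
    have "r p\<^sub>0 \<notin> r ` C"
    proof
      assume "r p\<^sub>0 \<in> r ` C"
      then obtain p where p: "p \<in> C" "r p = r p\<^sub>0" by force
      then have "p y = p\<^sub>0 y"
        using r_inj[of p p\<^sub>0 y] p0 y by (auto simp: C_def)
      then show False
        using p(1) p0y \<epsilon> by (auto simp: C_def)
    qed
    moreover have "r p \<in> topspace P'" if "p \<in> ?E" for p
      using that closedin_subset[OF E_closed] r_cont by (auto simp: continuous_map_def Pi_iff subset_iff)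
    ultimately have "r p\<^sub>0 \<in> topspace P' - r ` C"
      using p0 by blast
    then obtain B where B: "B \<in> \<B>" "r p\<^sub>0 \<in> B" "B \<subseteq> topspace P' - r ` C"
      using \<B>(3)[OF op] by blast
    have "p\<^sub>0 y \<in> mtopology closure_of Q" using Q(3) p0y by simp
    moreover have "openin mtopology (mball (p\<^sub>0 y) \<epsilon>)" "p\<^sub>0 y \<in> mball (p\<^sub>0 y) \<epsilon>"
      using p0y \<epsilon> by auto
    ultimately obtain c where c: "c \<in> Q" "c \<in> mball (p\<^sub>0 y) \<epsilon>"
      unfolding in_closure_of by blast
    have "p y \<in> mcball c (2 * \<epsilon>)" if p: "p \<in> ?E" "r p \<in> B" for p
    proof -
      have "p \<notin> C" using p(2) B(3) by blast
      moreover have "p \<in> topspace ?P" using p(1) closedin_subset[OF E_closed] by blast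
      ultimately have "p y \<in> mball (p\<^sub>0 y) \<epsilon>"
        using p(1) p_M[OF p(1) yM] by (auto simp: C_def)
      moreover have "d c (p y) \<le> d c (p\<^sub>0 y) + d (p\<^sub>0 y) (p y)"
        using c p0y p_M[OF p(1) yM] by (intro triangle) auto
      ultimately show ?thesis
        using c by (auto simp: commute)
    qed
    then show ?thesis using B(1,2) c(1) by blast
  qed
  define A where "A p c = {y \<in> Y\<^sub>0. p y \<in> mcball c (2 * \<epsilon>)}" for p c
  define I where "I \<F> = {(p, c). p \<in> ?E \<and> (\<exists>B. (B, c) \<in> \<F> \<and> r p \<in> B)}" for \<F> :: "(('x \<Rightarrow> 'x) set \<times> 'x) set"
  define T where "T \<F> = Y\<^sub>0 \<inter> (\<Inter>(p, c)\<in>I \<F>. A p c)" for \<F>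
  have T_mem: "p y \<in> mcball c (2 * \<epsilon>)" if "y \<in> T \<F>" "(B, c) \<in> \<F>" "p \<in> ?E" "r p \<in> B" for y \<F> B c p
  proof -
    have "(p, c) \<in> I \<F>"
      using that(2-4) by (auto simp: I_def)
    then have "y \<in> A p c"
      using that(1) by (auto simp: T_def)
    then show ?thesis
      by (simp add: A_def)
  qed
  have A_closed: "closedin Z (A p c)" if "p \<in> ?E" for p c
  proof -
    have "A p c = {y \<in> topspace Z. p y \<in> mcball c (2 * \<epsilon>)}"
      by (simp add: A_def tZ)
    then show ?thesis
      using closedin_continuous_map_preimage[OF p_cont[OF that] closedin_mcball]
      by (simp add: Z_def)
  qed
  have T_closed: "closedin Z (T \<F>)" for \<F>
  proof -
    have "T \<F> = \<Inter>(insert (topspace Z) ((\<lambda>(p, c). A p c) ` I \<F>))"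
      by (simp add: T_def tZ)
    moreover have "closedin Z \<dots>"
      by (rule closedin_Inter) (use A_closed in \<open>auto simp: I_def\<close>)
    ultimately show ?thesis by simp
  qed
  define \<G> where "\<G> = {\<F>. finite \<F> \<and> \<F> \<subseteq> \<B> \<times> Q \<and> (\<forall>p\<in>?E. \<exists>(B, c)\<in>\<F>. r p \<in> B)}"
  have "countable {\<F>. finite \<F> \<and> \<F> \<subseteq> \<B> \<times> Q}"
    using \<B>(1) Q(1) by (intro countable_Collect_finite_subset countable_SIGMA) auto
  then have G_count: "countable \<G>"
    by (rule countable_subset[rotated]) (auto simp: \<G>_def)
  have T_cover: "\<exists>\<F>\<in>\<G>. y \<in> T \<F>" if y: "y \<in> Y\<^sub>0" for y
  proof -
    obtain b c where bc: "\<And>p\<^sub>0. p\<^sub>0 \<in> ?E \<Longrightarrow> b p\<^sub>0 \<in> \<B>" "\<And>p\<^sub>0. p\<^sub>0 \<in> ?E \<Longrightarrow> c p\<^sub>0 \<in> Q"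
      "\<And>p\<^sub>0. p\<^sub>0 \<in> ?E \<Longrightarrow> r p\<^sub>0 \<in> b p\<^sub>0"
      "\<And>p\<^sub>0 p. p\<^sub>0 \<in> ?E \<Longrightarrow> p \<in> ?E \<Longrightarrow> r p \<in> b p\<^sub>0 \<Longrightarrow> p y \<in> mcball (c p\<^sub>0) (2 * \<epsilon>)"
      using local[OF y] by metis
    define N where "N p\<^sub>0 = {p \<in> topspace ?P. r p \<in> b p\<^sub>0}" for p\<^sub>0
    have "\<exists>K. finite K \<and> K \<subseteq> ?E \<and> ?E \<subseteq> (\<Union>p\<^sub>0\<in>K. N p\<^sub>0)"
    proof -
      have "openin ?P (N p\<^sub>0)" if "p\<^sub>0 \<in> ?E" for p\<^sub>0
        unfolding N_def by (rule openin_continuous_map_preimage[OF r_cont \<B>(2)[OF bc(1)[OF that]]])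
      then have "\<forall>U\<in>N ` ?E. openin ?P U"
        by blast
      moreover have "?E \<subseteq> \<Union>(N ` ?E)"
        using bc(3) closedin_subset[OF E_closed] unfolding N_def by blast
      ultimately obtain \<K> where "finite \<K>" "\<K> \<subseteq> N ` ?E" "?E \<subseteq> \<Union>\<K>"
        using E_compact unfolding compactin_def by meson
      then show ?thesis
        by (metis finite_subset_image)
    qed
    then obtain K where K: "finite K" "K \<subseteq> ?E" "?E \<subseteq> (\<Union>p\<^sub>0\<in>K. N p\<^sub>0)" by blast
    let ?F = "(\<lambda>p\<^sub>0. (b p\<^sub>0, c p\<^sub>0)) ` K"
    have "?F \<in> \<G>"
      unfolding \<G>_def using K bc(1,2) by (fastforce simp: N_def)
    moreover have "y \<in> T ?F"
      using y K(2) bc(4) by (auto simp: T_def I_def A_def)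
    ultimately show ?thesis by blast
  qed
  have "\<exists>\<F>\<in>\<G>. Z interior_of (T \<F>) \<noteq> {}"
  proof (rule ccontr)
    assume neg: "\<not> ?thesis"
    have "Z interior_of \<Union>(T ` \<G>) = {}"
      by (rule Baire_category_alt) (use Z_cm G_count neg T_closed in auto)
    moreover have "\<Union>(T ` \<G>) = topspace Z"
      using T_cover tZ by (auto simp: T_def)
    ultimately show False
      using \<open>Y\<^sub>0 \<noteq> {}\<close> tZ interior_of_topspace[of Z] by simp
  qed
  then obtain \<F> where F: "\<F> \<in> \<G>" "Z interior_of (T \<F>) \<noteq> {}" by blast
  obtain U where U: "openin mtopology U" "Z interior_of (T \<F>) = U \<inter> Y\<^sub>0"
    using openin_interior_of[of Z "T \<F>"] unfolding Z_def openin_subtopology by blast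
  have close0: "d (act g y) (act g y') \<le> 4 * \<epsilon>" if yy: "y \<in> U \<inter> Y\<^sub>0" "y' \<in> U \<inter> Y\<^sub>0" for g y y'
  proof -
    have T: "y \<in> T \<F>" "y' \<in> T \<F>"
      using yy U(2) interior_of_subset[of Z "T \<F>"] by blast+
    let ?p = "restrict (act g) M"
    have "?p \<in> ?P closure_of range (\<lambda>g. restrict (act g) M)"
      by (rule closure_of_subset[THEN subsetD]) (auto simp: act_in)
    then have p: "?p \<in> ?E" by (simp add: enveloping_semigroup_def)
    then obtain B c where "(B, c) \<in> \<F>" "r ?p \<in> B"
      using F(1) unfolding \<G>_def by blast
    then have "?p y \<in> mcball c (2 * \<epsilon>)" "?p y' \<in> mcball c (2 * \<epsilon>)"
      using T_mem[OF T(1) _ p] T_mem[OF T(2) _ p] by simp_all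
    then have "act g y \<in> mcball c (2 * \<epsilon>)" "act g y' \<in> mcball c (2 * \<epsilon>)"
      using yy Y0M by auto
    moreover then have "d (act g y) (act g y') \<le> d (act g y) c + d c (act g y')"
      by (intro triangle) auto
    ultimately show ?thesis
      by (auto simp: commute)
  qed
  \<comment> \<open>Each single \<open>g\<close> is continuous on \<open>Y\<close>, so the estimate extends from \<open>Y\<^sub>0\<close> to \<open>Y\<close> by density.\<close>
  have approx: "\<exists>y\<in>U \<inter> Y\<^sub>0. d (act g x) (act g y) < \<epsilon>" if x: "x \<in> U \<inter> Y" for g x
  proof -
    let ?N = "{z \<in> M. act g z \<in> mball (act g x) \<epsilon>}"
    have xM: "x \<in> M" using x YM by blast
    have "openin mtopology ?N"
      using openin_continuous_map_preimage[OF continuous_map_act openin_mball] by simp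
    then have op: "openin (subtopology mtopology Y) (U \<inter> ?N \<inter> Y)"
      using U(1) by (auto simp: openin_subtopology)
    have mem: "x \<in> U \<inter> ?N \<inter> Y"
      using x xM \<epsilon> act_in[OF xM] by auto
    have "\<forall>T. x \<in> T \<and> openin (subtopology mtopology Y) T \<longrightarrow> (\<exists>y. y \<in> Y\<^sub>0 \<and> y \<in> T)"
      using x Y0(2) in_closure_of[of x "subtopology mtopology Y" Y\<^sub>0] by simp
    from mp[OF spec[OF this] conjI[OF mem op]] have "\<exists>y. y \<in> Y\<^sub>0 \<and> y \<in> U \<inter> ?N \<inter> Y" .
    then show ?thesis by auto
  qed
  show ?thesis
  proof
    show "openin mtopology U" by (rule U(1))
    show "U \<inter> Y \<noteq> {}" using F(2) U(2) Y0Y by blast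
    show "orbit_dist x x' \<le> e" if xx: "x \<in> U \<inter> Y" "x' \<in> U \<inter> Y" for x x'
    proof (rule orbit_dist_le)
      fix g
      obtain y y' where y: "y \<in> U \<inter> Y\<^sub>0" "d (act g x) (act g y) < \<epsilon>"
        and y': "y' \<in> U \<inter> Y\<^sub>0" "d (act g x') (act g y') < \<epsilon>"
        using approx[OF xx(1)] approx[OF xx(2)] by blast
      have in_M: "act g x \<in> M" "act g x' \<in> M" "act g y \<in> M" "act g y' \<in> M"
        using xx y(1) y'(1) YM Y0M by (auto intro: act_in)
      have "d (act g x) (act g x') \<le> d (act g x) (act g y) + d (act g y) (act g x')"
        "d (act g y) (act g x') \<le> d (act g y) (act g y') + d (act g y') (act g x')"
        using in_M by (auto intro: triangle)
      then show "d (act g x) (act g x') \<le> e"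
        using y(2) y'(2) close0[OF y(1) y'(1), of g] by (simp add: \<epsilon>_def commute)
    qed
  qed
qed

text \<open>
For fixed \<open>e\<close> let \<open>O'\<close> be the largest open set that countably many \<open>orbit_dist\<close>-balls of radius
\<open>e\<close> cover. It is invariant because \<open>orbit_dist\<close> is. If its complement \<open>Y\<close> were nonempty, a
nonempty relatively open piece of \<open>Y\<close> of diameter at most \<open>e\<close> could be added to \<open>O'\<close>. Only closed
invariant sets \<open>Y\<close> occur here, which is why the condition for these already implies the condition
for all closed sets.
\<close>
theorem orbit_dist_separable:
  assumes gen: "\<And>Y. closedin mtopology Y \<Longrightarrow> invariant_set act Y \<Longrightarrow> generic_continuity mtopology act Y"
  obtains D where "countable D" "D \<subseteq> M" "\<And>x e. x \<in> M \<Longrightarrow> e > 0 \<Longrightarrow> \<exists>y\<in>D. orbit_dist x y < e"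
proof -
  have "\<exists>C. countable C \<and> C \<subseteq> M \<and> (\<forall>x\<in>M. \<exists>c\<in>C. orbit_dist x c \<le> e)" if e: "e > 0" for e
  proof -
    define thin where "thin U \<longleftrightarrow> (\<exists>C. countable C \<and> C \<subseteq> M \<and> (\<forall>x\<in>U. \<exists>c\<in>C. orbit_dist x c \<le> e))" for U
    define O' where "O' = \<Union>{U. openin mtopology U \<and> thin U}"
    have O_open: "openin mtopology O'"
      unfolding O'_def by (intro openin_Union) auto
    have O_M: "O' \<subseteq> M" using openin_subset[OF O_open] by simp
    obtain \<B> where \<B>: "countable \<B>" "\<And>B. B \<in> \<B> \<Longrightarrow> openin mtopology B"
      "\<And>U x. openin mtopology U \<Longrightarrow> x \<in> U \<Longrightarrow> \<exists>B\<in>\<B>. x \<in> B \<and> B \<subseteq> U"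
      using second_countable_M by (auto simp: second_countable_def)
    have thin_O: "thin O'"
    proof -
      have "\<exists>C. countable C \<and> C \<subseteq> M \<and> (\<forall>x\<in>B. \<exists>c\<in>C. orbit_dist x c \<le> e)" if "B \<in> {B \<in> \<B>. thin B}" for B
        using that by (auto simp: thin_def)
      then obtain C where C: "\<And>B. B \<in> {B \<in> \<B>. thin B} \<Longrightarrow> countable (C B) \<and> C B \<subseteq> M \<and> (\<forall>x\<in>B. \<exists>c\<in>C B. orbit_dist x c \<le> e)"
        by metis
      have "\<exists>c\<in>\<Union>(C ` {B \<in> \<B>. thin B}). orbit_dist x c \<le> e" if x: "x \<in> O'" for x
      proof -
        obtain U where U: "openin mtopology U" "thin U" "x \<in> U"
          using x by (auto simp: O'_def)
        obtain B where B: "B \<in> \<B>" "x \<in> B" "B \<subseteq> U"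
          using \<B>(3)[OF U(1,3)] by blast
        then have "thin B" using U(2) unfolding thin_def by blast
        then show ?thesis using C[of B] B by blast
      qed
      moreover have "countable (\<Union>(C ` {B \<in> \<B>. thin B}))"
        using C \<B>(1) by (intro countable_UN) auto
      moreover have "\<Union>(C ` {B \<in> \<B>. thin B}) \<subseteq> M"
        using C by blast
      ultimately show ?thesis unfolding thin_def by blast
    qed
    define Y where "Y = M - O'"
    have Y_closed: "closedin mtopology Y"
      unfolding Y_def using closedin_diff[OF closedin_topspace O_open] by simp
    have Y_inv: "invariant_set act Y"
      unfolding invariant_set_def
    proof (intro allI subsetI)
      fix g z assume "z \<in> act g ` Y"
      then obtain x where x: "x \<in> M" "x \<notin> O'" "z = act g x" by (auto simp: Y_def)
      have "act g x \<notin> O'"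
      proof
        assume in_O: "act g x \<in> O'"
        let ?U = "{x \<in> M. act g x \<in> O'}"
        obtain C where C: "countable C" "C \<subseteq> M" "\<And>x. x \<in> O' \<Longrightarrow> \<exists>c\<in>C. orbit_dist x c \<le> e"
          using thin_O unfolding thin_def by blast
        have "\<exists>c\<in>act (- g) ` C. orbit_dist y c \<le> e" if y: "y \<in> ?U" for y
        proof -
          obtain c where c: "c \<in> C" "orbit_dist (act g y) c \<le> e"
            using C(3) y by blast
          then have "orbit_dist y (act (- g) c) \<le> e"
            using orbit_dist_act[of y "act (- g) c" g] y C(2) by (simp add: act_in act_minus subset_iff)
          then show ?thesis using c(1) by blast
        qed
        moreover have "countable (act (- g) ` C)" "act (- g) ` C \<subseteq> M"
          using C(1,2) by (auto intro: act_in)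
        ultimately have "thin ?U" unfolding thin_def by blast
        moreover have "openin mtopology ?U"
          using openin_continuous_map_preimage[OF continuous_map_act O_open] by simp
        ultimately have "?U \<subseteq> O'" by (auto simp: O'_def)
        then show False using in_O x by blast
      qed
      then show "z \<in> Y" using x act_in by (simp add: Y_def)
    qed
    have "Y = {}"
    proof (rule ccontr)
      assume "Y \<noteq> {}"
      then obtain U where U: "openin mtopology U" "U \<inter> Y \<noteq> {}"
        "\<And>x y. x \<in> U \<inter> Y \<Longrightarrow> y \<in> U \<inter> Y \<Longrightarrow> orbit_dist x y \<le> e"
        using generic_continuity_imp_small_open_set[OF Y_closed _ gen[OF Y_closed Y_inv] e] by metis
      obtain z where z: "z \<in> U \<inter> Y" using U(2) by blast
      obtain C where C: "countable C" "C \<subseteq> M" "\<And>x. x \<in> O' \<Longrightarrow> \<exists>c\<in>C. orbit_dist x c \<le> e"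
        using thin_O unfolding thin_def by blast
      have UM: "U \<subseteq> M" using openin_subset[OF U(1)] by simp
      have "\<exists>c\<in>insert z C. orbit_dist x c \<le> e" if "x \<in> U" for x
        using U(3)[OF _ z, of x] C(3)[of x] that UM by (cases "x \<in> O'") (auto simp: Y_def)
      moreover have "countable (insert z C)" "insert z C \<subseteq> M"
        using C(1,2) z UM by auto
      ultimately have "thin U" unfolding thin_def by blast
      then have "U \<subseteq> O'" using U(1) by (auto simp: O'_def)
      then show False using z by (auto simp: Y_def)
    qed
    then have "O' = M" using O_M by (auto simp: Y_def)
    then show ?thesis using thin_O by (simp add: thin_def)
  qed
  then have "\<forall>n. \<exists>C. countable C \<and> C \<subseteq> M \<and> (\<forall>x\<in>M. \<exists>c\<in>C. orbit_dist x c \<le> inverse (Suc n))"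
    by simp
  then obtain C where C: "\<And>n. countable (C n) \<and> C n \<subseteq> M \<and> (\<forall>x\<in>M. \<exists>c\<in>C n. orbit_dist x c \<le> inverse (Suc n))"
    by metis
  show ?thesis
  proof
    show "countable (\<Union>n. C n)" "(\<Union>n. C n) \<subseteq> M" using C by auto
    fix x and e :: real assume x: "x \<in> M" and "e > 0"
    then obtain n where "inverse (Suc n) < e" using reals_Archimedean by blast
    moreover obtain c where "c \<in> C n" "orbit_dist x c \<le> inverse (Suc n)" using C[of n] x by blast
    ultimately show "\<exists>y\<in>\<Union>n. C n. orbit_dist x y < e" by force
  qed
qed

end

section \<open>A function space with vanishing oscillation seminorms\<close>

locale orbit_separable_action = compact_metric_action M d act
  for M :: "'x set" and d and act :: "'g::topological_group_add \<Rightarrow> 'x \<Rightarrow> 'x" +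
  fixes D :: "nat \<Rightarrow> 'x"
  assumes D_in: "D i \<in> M"
    and D_dense: "x \<in> M \<Longrightarrow> e > 0 \<Longrightarrow> \<exists>i. orbit_dist x (D i) < e"
begin

text \<open>
The oscillation seminorms \<open>N\<^sub>n v = sup \<bar>v x - v y\<bar> / weight n x y\<close> measure continuity with respect to
\<open>orbit_dist\<close>. The two terms balance: a function that is Lipschitz for \<open>orbit_dist\<close> has
\<open>N\<^sub>n v = O(2^-n)\<close>, while \<open>N\<^sub>n v \<le> 2^(n+1) sup \<bar>v\<bar>\<close>, so that for each fixed \<open>n\<close> the seminorm
is small on uniformly small functions.
\<close>
definition weight :: "nat \<Rightarrow> 'x \<Rightarrow> 'x \<Rightarrow> real" where
  "weight n x y = 2 ^ n * orbit_dist x y + (1/2) ^ n"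

text \<open>
The norm of the representation space is the maximum of \<open>sup \<bar>v\<bar>\<close> and all \<open>N\<^sub>n v\<close>. It is given by
its upper bounds \<open>C\<close>, so that no suprema have to be handled.
\<close>
definition norm_le :: "('x \<Rightarrow> real) \<Rightarrow> real \<Rightarrow> bool" where
  "norm_le v C \<longleftrightarrow> (\<forall>x\<in>M. \<bar>v x\<bar> \<le> C) \<and> (\<forall>n. \<forall>x\<in>M. \<forall>y\<in>M. \<bar>v x - v y\<bar> \<le> C * weight n x y)"

text \<open>
\<open>N\<^sub>n v\<close> tends to 0. This makes the space behave like a \<open>c\<^sub>0\<close>-sum, which is what makes its dual
separable.
\<close>
definition vanishing :: "('x \<Rightarrow> real) \<Rightarrow> bool" where
  "vanishing v \<longleftrightarrow> (\<forall>e>0. \<exists>N. \<forall>n\<ge>N. \<forall>x\<in>M. \<forall>y\<in>M. \<bar>v x - v y\<bar> \<le> e * weight n x y)"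

definition little :: "('x \<Rightarrow> real) set" where
  "little = {v. continuous_map mtopology euclideanreal v \<and> vanishing v}"

lemma weight_ge: "x \<in> M \<Longrightarrow> y \<in> M \<Longrightarrow> (1/2) ^ n \<le> weight n x y"
  "x \<in> M \<Longrightarrow> y \<in> M \<Longrightarrow> 2 ^ n * orbit_dist x y \<le> weight n x y"
  by (auto simp: weight_def orbit_dist_nonneg)

lemma weight_pos: "x \<in> M \<Longrightarrow> y \<in> M \<Longrightarrow> 0 < weight n x y"
  by (rule less_le_trans[OF _ weight_ge(1)]) auto

lemma weight_act: "x \<in> M \<Longrightarrow> y \<in> M \<Longrightarrow> weight n (act g x) (act g y) = weight n x y"
  by (simp add: weight_def orbit_dist_act)

lemma norm_leD1: "norm_le v C \<Longrightarrow> x \<in> M \<Longrightarrow> \<bar>v x\<bar> \<le> C"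
  and norm_leD2: "norm_le v C \<Longrightarrow> x \<in> M \<Longrightarrow> y \<in> M \<Longrightarrow> \<bar>v x - v y\<bar> \<le> C * weight n x y"
  by (auto simp: norm_le_def)

lemma norm_leI:
  assumes "\<And>x. x \<in> M \<Longrightarrow> \<bar>v x\<bar> \<le> C"
    and "\<And>n x y. x \<in> M \<Longrightarrow> y \<in> M \<Longrightarrow> \<bar>v x - v y\<bar> \<le> C * weight n x y"
  shows "norm_le v C"
  using assms by (auto simp: norm_le_def)

text \<open>
How the norm of a uniformly small function is estimated: the supremum controls \<open>N\<^sub>n v\<close> for the finitely many
\<open>n < N\<close>, so that only large \<open>n\<close> have to be considered.
\<close>
lemma norm_leI_split:
  assumes sup: "\<And>x. x \<in> M \<Longrightarrow> \<bar>v x\<bar> \<le> \<delta>" and "2 * \<delta> \<le> C * (1/2) ^ N" "\<delta> \<le> C" "0 \<le> C"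
    and large: "\<And>n x y. N \<le> n \<Longrightarrow> x \<in> M \<Longrightarrow> y \<in> M \<Longrightarrow> \<bar>v x - v y\<bar> \<le> C * weight n x y"
  shows "norm_le v C"
proof (rule norm_leI)
  show "\<bar>v x\<bar> \<le> C" if "x \<in> M" for x
    using sup[OF that] assms(3) by linarith
  show "\<bar>v x - v y\<bar> \<le> C * weight n x y" if xy: "x \<in> M" "y \<in> M" for n x y
  proof (cases "N \<le> n")
    case True
    then show ?thesis using large xy by blast
  next
    case False
    have "\<bar>v x - v y\<bar> \<le> 2 * \<delta>"
      using sup[OF xy(1)] sup[OF xy(2)] by linarith
    also have "\<dots> \<le> C * (1/2) ^ N" by fact
    also have "\<dots> \<le> C * (1/2) ^ n"
      using False \<open>0 \<le> C\<close> by (intro mult_left_mono power_decreasing) auto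
    also have "\<dots> \<le> C * weight n x y"
      using \<open>0 \<le> C\<close> weight_ge(1)[OF xy] by (rule mult_left_mono[rotated])
    finally show ?thesis .
  qed
qed

lemma vanishingD:
  assumes "vanishing v" "e > 0"
  obtains N where "\<And>n x y. N \<le> n \<Longrightarrow> x \<in> M \<Longrightarrow> y \<in> M \<Longrightarrow> \<bar>v x - v y\<bar> \<le> e * weight n x y"
  using assms unfolding vanishing_def by blast

lemma little_add:
  assumes "v \<in> little" "w \<in> little"
  shows "(\<lambda>x. v x + w x) \<in> little"
proof -
  have "vanishing (\<lambda>x. v x + w x)"
    unfolding vanishing_def
  proof (intro allI impI)
    fix e :: real assume e: "e > 0"
    obtain N where N: "\<And>n x y. N \<le> n \<Longrightarrow> x \<in> M \<Longrightarrow> y \<in> M \<Longrightarrow> \<bar>v x - v y\<bar> \<le> e/2 * weight n x y"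
      using vanishingD[of v "e/2"] assms(1) e by (auto simp: little_def)
    obtain N' where N': "\<And>n x y. N' \<le> n \<Longrightarrow> x \<in> M \<Longrightarrow> y \<in> M \<Longrightarrow> \<bar>w x - w y\<bar> \<le> e/2 * weight n x y"
      using vanishingD[of w "e/2"] assms(2) e by (auto simp: little_def)
    have "\<bar>(v x + w x) - (v y + w y)\<bar> \<le> e * weight n x y" if "max N N' \<le> n" "x \<in> M" "y \<in> M" for n x y
    proof -
      have "\<bar>v x - v y\<bar> \<le> e/2 * weight n x y" "\<bar>w x - w y\<bar> \<le> e/2 * weight n x y"
        using N N' that by auto
      then show ?thesis by linarith
    qed
    then show "\<exists>N. \<forall>n\<ge>N. \<forall>x\<in>M. \<forall>y\<in>M. \<bar>(v x + w x) - (v y + w y)\<bar> \<le> e * weight n x y"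
      by blast
  qed
  then show ?thesis
    using assms by (auto simp: little_def intro: continuous_map_add)
qed

lemma little_scale:
  assumes "v \<in> little"
  shows "(\<lambda>x. c * v x) \<in> little"
proof -
  have "vanishing (\<lambda>x. c * v x)"
    unfolding vanishing_def
  proof (intro allI impI)
    fix e :: real assume e: "e > 0"
    define b where "b = \<bar>c\<bar> + 1"
    have b: "b > 0" "\<bar>c\<bar> \<le> b" by (auto simp: b_def)
    obtain N where N: "\<And>n x y. N \<le> n \<Longrightarrow> x \<in> M \<Longrightarrow> y \<in> M \<Longrightarrow> \<bar>v x - v y\<bar> \<le> e/b * weight n x y"
      using vanishingD[of v "e/b"] assms e b by (auto simp: little_def)
    have "\<bar>c * v x - c * v y\<bar> \<le> e * weight n x y" if "N \<le> n" "x \<in> M" "y \<in> M" for n x y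
    proof -
      have "\<bar>c * v x - c * v y\<bar> = \<bar>c\<bar> * \<bar>v x - v y\<bar>"
        by (simp flip: abs_mult right_diff_distrib)
      also have "\<dots> \<le> b * (e/b * weight n x y)"
        using N[OF that] b by (intro mult_mono) auto
      also have "\<dots> = e * weight n x y" using b by simp
      finally show ?thesis .
    qed
    then show "\<exists>N. \<forall>n\<ge>N. \<forall>x\<in>M. \<forall>y\<in>M. \<bar>c * v x - c * v y\<bar> \<le> e * weight n x y"
      by blast
  qed
  then show ?thesis
    using assms by (auto simp: little_def intro: continuous_map_real_mult_left)
qed

lemma little_diff:
  assumes "v \<in> little" "w \<in> little"
  shows "(\<lambda>x. v x - w x) \<in> little"
  using little_add[OF assms(1) little_scale[OF assms(2), of "-1"]] by simp

lemma little_act: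
  assumes "v \<in> little"
  shows "(\<lambda>x. v (act g x)) \<in> little"
proof -
  have "vanishing (\<lambda>x. v (act g x))"
    unfolding vanishing_def
  proof (intro allI impI)
    fix e :: real assume e: "e > 0"
    obtain N where N: "\<And>n x y. N \<le> n \<Longrightarrow> x \<in> M \<Longrightarrow> y \<in> M \<Longrightarrow> \<bar>v x - v y\<bar> \<le> e * weight n x y"
      using vanishingD[of v e] assms e by (auto simp: little_def)
    have "\<bar>v (act g x) - v (act g y)\<bar> \<le> e * weight n x y" if "N \<le> n" "x \<in> M" "y \<in> M" for n x y
      using N[OF that(1) act_in[OF that(2)] act_in[OF that(3)], of g g] weight_act[OF that(2,3)] by simp
    then show "\<exists>N. \<forall>n\<ge>N. \<forall>x\<in>M. \<forall>y\<in>M. \<bar>v (act g x) - v (act g y)\<bar> \<le> e * weight n x y"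
      by blast
  qed
  moreover have "continuous_map mtopology euclideanreal (\<lambda>x. v (act g x))"
    using continuous_map_compose[OF continuous_map_act, of euclideanreal v g] assms
    by (simp add: little_def o_def)
  ultimately show ?thesis by (simp add: little_def)
qed

lemma norm_le_act:
  assumes "norm_le v C"
  shows "norm_le (\<lambda>x. v (act g x)) C"
proof (rule norm_leI)
  show "\<bar>v (act g x)\<bar> \<le> C" if "x \<in> M" for x
    by (rule norm_leD1[OF assms act_in[OF that]])
  show "\<bar>v (act g x) - v (act g y)\<bar> \<le> C * weight n x y" if "x \<in> M" "y \<in> M" for n x y
    using norm_leD2[OF assms act_in[OF that(1)] act_in[OF that(2)], of g g n] weight_act[OF that] by simp
qed

lemma little_norm_le:
  assumes "v \<in> little"
  obtains C where "0 \<le> C" "norm_le v C"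
proof -
  have v: "continuous_map mtopology euclideanreal v" "vanishing v"
    using assms by (auto simp: little_def)
  have "topspace mtopology \<noteq> {}" using D_in by auto
  then obtain b where b: "\<And>x. x \<in> M \<Longrightarrow> \<bar>v x\<bar> \<le> \<bar>v b\<bar>"
    using continuous_map_attains_sup[OF compact_M _ continuous_map_real_abs[OF v(1)]] by auto
  obtain N where N: "\<And>n x y. N \<le> n \<Longrightarrow> x \<in> M \<Longrightarrow> y \<in> M \<Longrightarrow> \<bar>v x - v y\<bar> \<le> 1 * weight n x y"
    using vanishingD[OF v(2), of 1] by auto
  define C where "C = 2 * \<bar>v b\<bar> * 2 ^ N + 1"
  have "norm_le v C"
  proof (rule norm_leI_split[OF b])
    have "C * (1/2) ^ N = 2 * \<bar>v b\<bar> * (2 * (1/2)) ^ N + (1/2) ^ N"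
      unfolding power_mult_distrib by (simp add: C_def algebra_simps)
    then show "2 * \<bar>v b\<bar> \<le> C * (1/2) ^ N"
      by simp
    have "1 * \<bar>v b\<bar> \<le> (2 * 2 ^ N) * \<bar>v b\<bar>"
      by (intro mult_right_mono) (auto intro: order_trans[OF one_le_power[of 2 N]])
    then show "\<bar>v b\<bar> \<le> C" by (simp add: C_def algebra_simps)
    show "0 \<le> C" by (simp add: C_def)
    have "1 \<le> C" by (simp add: C_def)
    then show "\<bar>v x - v y\<bar> \<le> C * weight n x y" if "N \<le> n" "x \<in> M" "y \<in> M" for n x y
      using N[OF that] mult_right_mono[of 1 C "weight n x y"] weight_pos[OF that(2,3), of n] by linarith
  qed
  moreover have "0 \<le> C" by (simp add: C_def)
  ultimately show ?thesis using that by blast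
qed

text \<open>
Coordinates for an isometric embedding into the bounded sequences: \<open>n = 0\<close> gives the values of \<open>v\<close>,
\<open>n = m + 1\<close> the quotients in \<open>N\<^sub>m\<close>, all at points of the countable set \<open>D\<close>. The space of the
representation has to consist of bounded sequences because this is the Banach space over which \<open>RN\<close> is
defined.
\<close>
definition coord :: "('x \<Rightarrow> real) \<Rightarrow> nat \<times> nat \<times> nat \<Rightarrow> real" where
  "coord v = (\<lambda>(n, i, j). case n of 0 \<Rightarrow> v (D i) | Suc m \<Rightarrow> (v (D i) - v (D j)) / weight m (D i) (D j))"

definition coords :: "('x \<Rightarrow> real) \<Rightarrow> (nat discrete \<Rightarrow>\<^sub>C real)" where
  "coords v = Bcontfun (\<lambda>k. coord v (from_nat (of_discrete k)))"

lemma coord_le: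
  assumes "norm_le v C"
  shows "\<bar>coord v k\<bar> \<le> C"
proof -
  obtain n i j where k: "k = (n, i, j)" by (cases k)
  show ?thesis
  proof (cases n)
    case 0
    then show ?thesis using norm_leD1[OF assms D_in] by (simp add: k coord_def)
  next
    case (Suc m)
    then show ?thesis
      using norm_leD2[OF assms D_in D_in, of i j m] weight_pos[OF D_in D_in, of m i j]
      by (simp add: k coord_def abs_divide pos_divide_le_eq)
  qed
qed

lemma apply_coords:
  assumes "v \<in> little"
  shows "apply_bcontfun (coords v) k = coord v (from_nat (of_discrete k))"
proof -
  obtain C where "norm_le v C" using little_norm_le[OF assms] by blast
  then have "bounded (range (\<lambda>k::nat discrete. coord v (from_nat (of_discrete k))))"
    by (intro boundedI[of _ C]) (auto intro: coord_le)
  moreover have "continuous_on UNIV (\<lambda>k::nat discrete. coord v (from_nat (of_discrete k)))"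
    unfolding continuous_on_def by (intro ballI topological_tendstoI)
      (use open_discrete in \<open>force simp: eventually_at_topological\<close>)
  ultimately show ?thesis
    unfolding coords_def by (simp add: Bcontfun_inverse bcontfun_def)
qed

lemma apply_coords_to_nat:
  assumes "v \<in> little"
  shows "apply_bcontfun (coords v) (discrete (to_nat k)) = coord v k"
  by (simp add: apply_coords[OF assms] discrete_inverse)

text \<open>
Density of \<open>D\<close> for \<open>orbit_dist\<close>, and not only for \<open>d\<close>, is essential: the weights are continuous
for \<open>orbit_dist\<close> only.
\<close>
lemma D_approx:
  assumes "x \<in> M"
  obtains s where "(\<lambda>k. orbit_dist x (D (s k))) \<longlonglongrightarrow> 0"
    "\<And>v. continuous_map mtopology euclideanreal v \<Longrightarrow> (\<lambda>k. v (D (s k))) \<longlonglongrightarrow> v x"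
proof -
  have "\<forall>k. \<exists>i. orbit_dist x (D i) < inverse (Suc k)"
    using D_dense[OF assms] by simp
  then obtain s where s: "\<And>k. orbit_dist x (D (s k)) < inverse (Suc k)" by metis
  have lim: "(\<lambda>k. orbit_dist x (D (s k))) \<longlonglongrightarrow> 0"
    by (rule Lim_null_comparison[OF _ LIMSEQ_inverse_real_of_nat])
      (use s orbit_dist_nonneg[OF assms D_in] in \<open>auto intro!: always_eventually less_imp_le\<close>)
  have "(\<lambda>k. d (D (s k)) x) \<longlonglongrightarrow> 0"
    by (rule Lim_null_comparison[OF _ lim])
      (use dist_le_orbit_dist[OF assms D_in, of 0] assms D_in in \<open>auto simp: act_zero commute\<close>)
  then have "limitin mtopology (\<lambda>k. D (s k)) x sequentially"
    using assms D_in by (simp add: limitin_metric_dist_null)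
  then have "(\<lambda>k. v (D (s k))) \<longlonglongrightarrow> v x" if "continuous_map mtopology euclideanreal v" for v
    using continuous_map_limit[OF that, of "\<lambda>k. D (s k)" x sequentially] by (simp add: o_def)
  then show ?thesis using that lim by blast
qed

text \<open>
The norm of the coordinate sequence is the norm that \<open>norm_le\<close> describes, because the quotients at points of
\<open>D\<close> approximate those at all points.
\<close>
lemma norm_coords_le:
  assumes v: "v \<in> little"
  shows "norm (coords v) \<le> C \<longleftrightarrow> norm_le v C"
proof
  assume "norm_le v C"
  then show "norm (coords v) \<le> C"
    by (intro norm_bound) (simp add: apply_coords[OF v] coord_le)
next
  assume nT: "norm (coords v) \<le> C"
  have vc: "continuous_map mtopology euclideanreal v" using v by (simp add: little_def)
  have c: "\<bar>coord v k\<bar> \<le> C" for k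
    using norm_bounded[of "coords v" "discrete (to_nat k)"] nT by (simp add: apply_coords_to_nat[OF v])
  show "norm_le v C"
  proof (rule norm_leI)
    fix x assume x: "x \<in> M"
    then obtain s where s: "\<And>v. continuous_map mtopology euclideanreal v \<Longrightarrow> (\<lambda>k. v (D (s k))) \<longlonglongrightarrow> v x"
      using D_approx by blast
    have "(\<lambda>k. \<bar>v (D (s k))\<bar>) \<longlonglongrightarrow> \<bar>v x\<bar>"
      using s[OF vc] by (rule tendsto_rabs)
    then show "\<bar>v x\<bar> \<le> C"
      by (rule LIMSEQ_le_const2) (use c[of "(0, _, 0)"] in \<open>auto simp: coord_def\<close>)
    fix n y assume y: "y \<in> M"
    obtain s where s: "(\<lambda>k. orbit_dist x (D (s k))) \<longlonglongrightarrow> 0" "(\<lambda>k. v (D (s k))) \<longlonglongrightarrow> v x"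
      using D_approx[OF x] vc by metis
    obtain t where t: "(\<lambda>k. orbit_dist y (D (t k))) \<longlonglongrightarrow> 0" "(\<lambda>k. v (D (t k))) \<longlonglongrightarrow> v y"
      using D_approx[OF y] vc by metis
    have "0 \<le> C" using c[of "(0,0,0)"] by linarith
    have "\<bar>v (D (s k)) - v (D (t k))\<bar> \<le>
        C * (2 ^ n * (orbit_dist x (D (s k)) + orbit_dist x y + orbit_dist y (D (t k))) + (1/2) ^ n)" for k
    proof -
      have w: "0 < weight n (D (s k)) (D (t k))"
        by (rule weight_pos[OF D_in D_in])
      have "\<bar>v (D (s k)) - v (D (t k))\<bar> \<le> C * weight n (D (s k)) (D (t k))"
        using c[of "(Suc n, s k, t k)"] w by (simp add: coord_def abs_divide pos_divide_le_eq)
      moreover have "orbit_dist (D (s k)) (D (t k)) \<le> orbit_dist x (D (s k)) + orbit_dist x y + orbit_dist y (D (t k))"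
        using orbit_dist_triangle[OF D_in x D_in, of "s k" "t k"] orbit_dist_triangle[OF x y D_in, of "t k"]
        by (simp add: orbit_dist_commute)
      then have "C * weight n (D (s k)) (D (t k)) \<le>
          C * (2 ^ n * (orbit_dist x (D (s k)) + orbit_dist x y + orbit_dist y (D (t k))) + (1/2) ^ n)"
        unfolding weight_def using \<open>0 \<le> C\<close> by (intro mult_left_mono add_right_mono) auto
      ultimately show ?thesis by linarith
    qed
    moreover have "(\<lambda>k. \<bar>v (D (s k)) - v (D (t k))\<bar>) \<longlonglongrightarrow> \<bar>v x - v y\<bar>"
      by (intro tendsto_intros s t)
    moreover have "(\<lambda>k. C * (2 ^ n * (orbit_dist x (D (s k)) + orbit_dist x y + orbit_dist y (D (t k))) + (1/2) ^ n))
        \<longlonglongrightarrow> C * (2 ^ n * (0 + orbit_dist x y + 0) + (1/2) ^ n)"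
      by (intro tendsto_intros s t)
    ultimately have "\<bar>v x - v y\<bar> \<le> C * (2 ^ n * (0 + orbit_dist x y + 0) + (1/2) ^ n)"
      by (intro LIMSEQ_le) auto
    then show "\<bar>v x - v y\<bar> \<le> C * weight n x y"
      by (simp add: weight_def)
  qed
qed

lemma coords_add: "v \<in> little \<Longrightarrow> w \<in> little \<Longrightarrow> coords (\<lambda>x. v x + w x) = coords v + coords w"
  by (rule bcontfun_eqI)
    (auto simp: apply_coords little_add coord_def add_divide_distrib diff_divide_distrib split: nat.split prod.split)

lemma coords_scale: "v \<in> little \<Longrightarrow> coords (\<lambda>x. c * v x) = c *\<^sub>R coords v"
  by (rule bcontfun_eqI)
    (auto simp: apply_coords little_scale coord_def right_diff_distrib split: nat.split prod.split)

lemma coords_diff: "v \<in> little \<Longrightarrow> w \<in> little \<Longrightarrow> coords (\<lambda>x. v x - w x) = coords v - coords w"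
  using coords_add[OF _ little_scale[of w "-1"]] coords_scale[of w "-1"] by simp

lemma coords_cong:
  assumes "\<And>x. x \<in> M \<Longrightarrow> v x = w x"
  shows "coords v = coords w"
proof -
  have "coord v k = coord w k" for k
    by (cases k) (auto simp: coord_def D_in assms split: nat.split)
  then have "coord v = coord w" by blast
  then show ?thesis by (simp add: coords_def)
qed

lemma coords_inj:
  assumes "v \<in> little" "w \<in> little" "coords v = coords w" "x \<in> M"
  shows "v x = w x"
proof -
  have "norm (coords (\<lambda>x. v x - w x)) \<le> 0" using assms by (simp add: coords_diff)
  then have "norm_le (\<lambda>x. v x - w x) 0"
    using norm_coords_le[OF little_diff[OF assms(1,2)]] by blast
  then show ?thesis using norm_leD1[OF _ assms(4)] by fastforce
qed

lemma vanishing_limit: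
  assumes "\<And>e. e > 0 \<Longrightarrow> \<exists>w\<in>little. norm_le (\<lambda>x. w x - v x) e"
  shows "v \<in> little"
proof -
  have "continuous_map mtopology euclideanreal v"
  proof (rule continuous_map_realI)
    fix x and e :: real assume x: "x \<in> topspace mtopology" and e: "e > 0"
    then obtain w where w: "w \<in> little" "norm_le (\<lambda>x. w x - v x) (e/4)"
      using assms[of "e/4"] by auto
    have wc: "continuous_map mtopology euclideanreal w" using w(1) by (simp add: little_def)
    let ?U = "{y \<in> topspace mtopology. w y \<in> ball (w x) (e/4)}"
    have "openin mtopology ?U"
      using wc by (rule openin_continuous_map_preimage) auto
    moreover have "x \<in> ?U" using x e by simp
    moreover have "\<forall>y\<in>?U. \<bar>v y - v x\<bar> < e"
    proof
      fix y assume y: "y \<in> ?U"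
      then have "\<bar>w x - w y\<bar> < e/4" by (simp add: dist_real_def)
      moreover have "\<bar>w y - v y\<bar> \<le> e/4" "\<bar>w x - v x\<bar> \<le> e/4"
        using norm_leD1[OF w(2)] x y by auto
      ultimately show "\<bar>v y - v x\<bar> < e" using e by linarith
    qed
    ultimately show "\<exists>U. openin mtopology U \<and> x \<in> U \<and> (\<forall>y\<in>U. \<bar>v y - v x\<bar> < e)" by blast
  qed
  moreover have "vanishing v"
    unfolding vanishing_def
  proof (intro allI impI)
    fix e :: real assume e: "e > 0"
    obtain w where w: "w \<in> little" "norm_le (\<lambda>x. w x - v x) (e/2)"
      using assms[of "e/2"] e by auto
    obtain N where N: "\<And>n x y. N \<le> n \<Longrightarrow> x \<in> M \<Longrightarrow> y \<in> M \<Longrightarrow> \<bar>w x - w y\<bar> \<le> e/2 * weight n x y"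
      using vanishingD[of w "e/2"] w(1) e by (auto simp: little_def)
    have "\<bar>v x - v y\<bar> \<le> e * weight n x y" if xy: "N \<le> n" "x \<in> M" "y \<in> M" for n x y
    proof -
      have "\<bar>(w x - v x) - (w y - v y)\<bar> \<le> e/2 * weight n x y"
        using norm_leD2[OF w(2) xy(2,3)] by simp
      then show ?thesis using N[OF xy] by linarith
    qed
    then show "\<exists>N. \<forall>n\<ge>N. \<forall>x\<in>M. \<forall>y\<in>M. \<bar>v x - v y\<bar> \<le> e * weight n x y" by blast
  qed
  ultimately show ?thesis by (simp add: little_def)
qed

text \<open>
Completeness: uniform limits keep continuity, and vanishing of the \<open>N\<^sub>n\<close> is preserved under limits in
the norm.
\<close>
lemma banach_subspace_coords: "banach_subspace (coords ` little)"
  unfolding banach_subspace_def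
proof
  have "vanishing (\<lambda>_. 0)"
    unfolding vanishing_def using weight_pos by (fastforce intro: less_imp_le)
  then have zero: "(\<lambda>_. 0) \<in> little"
    by (simp add: little_def)
  show "subspace (coords ` little)"
  proof (rule subspaceI)
    show "0 \<in> coords ` little"
      using coords_scale[OF zero, of 0] zero by (metis imageI mult_zero_left scaleR_zero_left)
    show "v + w \<in> coords ` little" if vw: "v \<in> coords ` little" "w \<in> coords ` little" for v w
    proof -
      obtain v' w' where "v = coords v'" "w = coords w'" and vw': "v' \<in> little" "w' \<in> little"
        using vw by blast
      then have "v + w = coords (\<lambda>x. v' x + w' x)" by (simp add: coords_add)
      then show ?thesis using little_add[OF vw'] by blast
    qed
    show "c *\<^sub>R v \<in> coords ` little" if v: "v \<in> coords ` little" for c v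
    proof -
      obtain v' where "v = coords v'" and v': "v' \<in> little"
        using v by blast
      then have "c *\<^sub>R v = coords (\<lambda>x. c * v' x)" by (simp add: coords_scale)
      then show ?thesis using little_scale[OF v'] by blast
    qed
  qed
  show "closed (coords ` little)"
    unfolding closed_sequential_limits
  proof (intro allI impI, elim conjE)
    fix f w assume f: "\<forall>n. f n \<in> coords ` little" and lim: "f \<longlonglongrightarrow> w"
    then have "\<forall>n. \<exists>v. v \<in> little \<and> f n = coords v" by blast
    then obtain v where v: "\<And>n. v n \<in> little" "\<And>n. f n = coords (v n)" by metis
    have cauchy: "\<exists>K. \<forall>k\<ge>K. \<forall>l\<ge>K. norm_le (\<lambda>x. v k x - v l x) e" if e: "e > 0" for e
    proof -
      obtain K where K: "\<And>k l. K \<le> k \<Longrightarrow> K \<le> l \<Longrightarrow> dist (f k) (f l) < e"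
        using LIMSEQ_imp_Cauchy[OF lim] e unfolding Cauchy_def by blast
      have "norm_le (\<lambda>x. v k x - v l x) e" if "K \<le> k" "K \<le> l" for k l
      proof -
        have "norm (coords (\<lambda>x. v k x - v l x)) \<le> e"
          using K[OF that] by (simp add: coords_diff v dist_norm)
        then show ?thesis
          using norm_coords_le[OF little_diff[OF v(1) v(1)]] by blast
      qed
      then show ?thesis by blast
    qed
    define u where "u x = lim (\<lambda>k. v k x)" for x
    have conv: "(\<lambda>k. v k x) \<longlonglongrightarrow> u x" if x: "x \<in> M" for x
    proof -
      have "Cauchy (\<lambda>k. v k x)"
      proof (rule metric_CauchyI)
        fix e :: real assume "e > 0"
        then obtain K where K: "\<forall>k\<ge>K. \<forall>l\<ge>K. norm_le (\<lambda>x. v k x - v l x) (e/2)"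
          using cauchy[of "e/2"] by auto
        have "dist (v k x) (v l x) < e" if "K \<le> k" "K \<le> l" for k l
        proof -
          have "norm_le (\<lambda>x. v k x - v l x) (e/2)" using K that by blast
          from norm_leD1[OF this x] show ?thesis
            using \<open>e > 0\<close> by (simp add: dist_real_def)
        qed
        then show "\<exists>K. \<forall>k\<ge>K. \<forall>l\<ge>K. dist (v k x) (v l x) < e" by blast
      qed
      then show ?thesis
        by (simp add: u_def Cauchy_convergent_iff convergent_LIMSEQ_iff)
    qed
    have close: "\<exists>K. \<forall>k\<ge>K. norm_le (\<lambda>x. v k x - u x) e" if e: "e > 0" for e
    proof -
      obtain K where K: "\<forall>k\<ge>K. \<forall>l\<ge>K. norm_le (\<lambda>x. v k x - v l x) e"
        using cauchy[OF e] by blast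
      have "norm_le (\<lambda>x. v k x - u x) e" if k: "K \<le> k" for k
      proof (rule norm_leI)
        have kl: "norm_le (\<lambda>x. v k x - v l x) e" if "K \<le> l" for l
          using K k that by blast
        fix x assume x: "x \<in> M"
        have "(\<lambda>l. \<bar>v k x - v l x\<bar>) \<longlonglongrightarrow> \<bar>v k x - u x\<bar>"
          by (intro tendsto_intros conv x)
        then show "\<bar>v k x - u x\<bar> \<le> e"
          by (rule LIMSEQ_le_const2) (use norm_leD1[OF kl x] in blast)
        fix n y assume y: "y \<in> M"
        have "(\<lambda>l. \<bar>(v k x - v l x) - (v k y - v l y)\<bar>) \<longlonglongrightarrow> \<bar>(v k x - u x) - (v k y - u y)\<bar>"
          by (intro tendsto_intros conv x y)
        then show "\<bar>(v k x - u x) - (v k y - u y)\<bar> \<le> e * weight n x y"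
          by (rule LIMSEQ_le_const2) (use norm_leD2[OF kl x y] in blast)
      qed
      then show ?thesis by blast
    qed
    have u: "u \<in> little"
      by (rule vanishing_limit) (use close v(1) in blast)
    have "f \<longlonglongrightarrow> coords u"
    proof (rule metric_LIMSEQ_I)
      fix e :: real assume e: "e > 0"
      then obtain K where K: "\<forall>k\<ge>K. norm_le (\<lambda>x. v k x - u x) (e/2)"
        using close[of "e/2"] by auto
      have "dist (f k) (coords u) < e" if "K \<le> k" for k
      proof -
        have "norm (coords (\<lambda>x. v k x - u x)) \<le> e/2"
          using K that norm_coords_le[OF little_diff[OF v(1) u]] by blast
        then show ?thesis using e by (simp add: coords_diff v u dist_norm)
      qed
      then show "\<exists>K. \<forall>k\<ge>K. dist (f k) (coords u) < e" by blast
    qed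
    then have "w = coords u" using lim LIMSEQ_unique by blast
    then show "w \<in> coords ` little" using u by blast
  qed
qed

text \<open>
The function with a given coordinate sequence. It is determined on \<open>M\<close> only; a choice is made outside.
\<close>
definition ev :: "(nat discrete \<Rightarrow>\<^sub>C real) \<Rightarrow> 'x \<Rightarrow> real" where
  "ev w = (SOME v. v \<in> little \<and> coords v = w)"

lemma ev_little: "w \<in> coords ` little \<Longrightarrow> ev w \<in> little"
  and coords_ev: "w \<in> coords ` little \<Longrightarrow> coords (ev w) = w"
  using someI_ex[of "\<lambda>v. v \<in> little \<and> coords v = w"] unfolding ev_def by blast+

lemma ev_coords: "v \<in> little \<Longrightarrow> x \<in> M \<Longrightarrow> ev (coords v) x = v x"
  by (rule coords_inj[OF ev_little[OF imageI] _ coords_ev[OF imageI]])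

lemma ev_add:
  assumes "v \<in> coords ` little" "w \<in> coords ` little" "x \<in> M"
  shows "ev (v + w) x = ev v x + ev w x"
  using ev_coords[OF little_add[OF ev_little[OF assms(1)] ev_little[OF assms(2)]] assms(3)]
  by (simp add: coords_add ev_little coords_ev assms)

lemma ev_scale:
  assumes "w \<in> coords ` little" "x \<in> M"
  shows "ev (c *\<^sub>R w) x = c * ev w x"
  using ev_coords[OF little_scale[OF ev_little[OF assms(1)]] assms(2)]
  by (simp add: coords_scale ev_little coords_ev assms)

lemma norm_le_ev: "w \<in> coords ` little \<Longrightarrow> norm w \<le> C \<longleftrightarrow> norm_le (ev w) C"
  using norm_coords_le[OF ev_little] by (simp add: coords_ev)

lemma ev_le_norm: "w \<in> coords ` little \<Longrightarrow> x \<in> M \<Longrightarrow> \<bar>ev w x\<bar> \<le> norm w"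
  using norm_le_ev[of w "norm w"] by (auto intro: norm_leD1)

end

section \<open>Separability of the dual\<close>

definition functional_on :: "'b::real_vector set \<Rightarrow> ('b \<Rightarrow> real) \<Rightarrow> bool" where
  "functional_on W f \<longleftrightarrow> (\<forall>v\<in>W. \<forall>w\<in>W. f (v + w) = f v + f w) \<and> (\<forall>c. \<forall>v\<in>W. f (c *\<^sub>R v) = c * f v)"

lemma functional_on_add: "functional_on W f \<Longrightarrow> v \<in> W \<Longrightarrow> w \<in> W \<Longrightarrow> f (v + w) = f v + f w"
  and functional_on_scale: "functional_on W f \<Longrightarrow> v \<in> W \<Longrightarrow> f (c *\<^sub>R v) = c * f v"
  by (auto simp: functional_on_def)

lemma functional_on_diff:
  assumes "functional_on W f" "subspace W" "v \<in> W" "w \<in> W"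
  shows "f (v - w) = f v - f w"
  using functional_on_add[OF assms(1,3) subspace_scale[OF assms(2,4)], of "-1"]
    functional_on_scale[OF assms(1,4), of "-1"] by simp

lemma functional_on_subset: "functional_on W f \<Longrightarrow> W' \<subseteq> W \<Longrightarrow> functional_on W' f"
  unfolding functional_on_def by blast

text \<open>
The one-dimensional step of the Hahn-Banach theorem, read backwards: a functional that is small on the
kernel of \<open>\<delta>\<close> is, up to a multiple of \<open>\<delta>\<close>, small with the same constant.
\<close>
lemma functional_extension_step:
  fixes W :: "'b::real_normed_vector set"
  assumes W: "subspace W" and \<psi>: "functional_on W \<psi>" and \<delta>: "functional_on W \<delta>" and "0 \<le> \<epsilon>"
    and ker: "\<And>w. w \<in> W \<Longrightarrow> \<delta> w = 0 \<Longrightarrow> \<bar>\<psi> w\<bar> \<le> \<epsilon> * norm w"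
  shows "\<exists>c. \<forall>w\<in>W. \<bar>\<psi> w - c * \<delta> w\<bar> \<le> \<epsilon> * norm w"
proof (cases "\<exists>w\<in>W. \<delta> w \<noteq> 0")
  case False
  then show ?thesis using ker by (intro exI[of _ 0]) auto
next
  case True
  then obtain w0 where w0: "w0 \<in> W" "\<delta> w0 \<noteq> 0" by blast
  define S where "S = {w \<in> W. \<delta> w = 1}"
  have "inverse (\<delta> w0) *\<^sub>R w0 \<in> S"
    using w0 W \<delta> by (simp add: S_def subspace_scale functional_on_scale)
  then have "S \<noteq> {}" by blast
  have sep: "\<psi> w - \<epsilon> * norm w \<le> \<psi> w' + \<epsilon> * norm w'" if w: "w \<in> S" and w': "w' \<in> S" for w w'
  proof -
    have in_W: "w \<in> W" "w' \<in> W" and one: "\<delta> w = 1" "\<delta> w' = 1"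
      using w w' by (auto simp: S_def)
    have "\<delta> (w - w') = 0"
      using functional_on_diff[OF \<delta> W in_W] one by simp
    then have "\<bar>\<psi> (w - w')\<bar> \<le> \<epsilon> * norm (w - w')"
      using W in_W by (intro ker subspace_diff)
    also have "\<dots> \<le> \<epsilon> * (norm w + norm w')"
      using \<open>0 \<le> \<epsilon>\<close> by (intro mult_left_mono norm_triangle_ineq4)
    finally show ?thesis
      using functional_on_diff[OF \<psi> W in_W] by (simp add: algebra_simps abs_le_iff)
  qed
  define c where "c = (SUP w\<in>S. \<psi> w - \<epsilon> * norm w)"
  obtain w1 where w1: "w1 \<in> S" using \<open>S \<noteq> {}\<close> by blast
  have lower: "\<psi> w - \<epsilon> * norm w \<le> c" if "w \<in> S" for w
    unfolding c_def
    by (intro cSUP_upper that bdd_aboveI[of _ "\<psi> w1 + \<epsilon> * norm w1"]) (use sep w1 in auto)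
  have upper: "c \<le> \<psi> w + \<epsilon> * norm w" if "w \<in> S" for w
    unfolding c_def using \<open>S \<noteq> {}\<close> sep that by (intro cSUP_least) auto
  have "\<bar>\<psi> w - c * \<delta> w\<bar> \<le> \<epsilon> * norm w" if w: "w \<in> W" for w
  proof (cases "\<delta> w = 0")
    case True
    then show ?thesis using ker w by simp
  next
    case False
    define u where "u = inverse (\<delta> w) *\<^sub>R w"
    have u: "u \<in> S"
      using w False W \<delta> by (simp add: u_def S_def subspace_scale functional_on_scale)
    have w_u: "w = \<delta> w *\<^sub>R u" using False by (simp add: u_def)
    have "u \<in> W" using u by (simp add: S_def)
    have "\<bar>\<psi> u - c\<bar> \<le> \<epsilon> * norm u"
      using lower[OF u] upper[OF u] by linarith
    then have "\<bar>\<delta> w\<bar> * \<bar>\<psi> u - c\<bar> \<le> \<bar>\<delta> w\<bar> * (\<epsilon> * norm u)"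
      by (rule mult_left_mono) simp
    moreover have "\<psi> w - c * \<delta> w = \<delta> w * (\<psi> u - c)"
      using functional_on_scale[OF \<psi> \<open>u \<in> W\<close>, of "\<delta> w"] w_u by (simp add: algebra_simps)
    moreover have "norm w = \<bar>\<delta> w\<bar> * norm u"
      using w_u by (metis norm_scaleR)
    ultimately show ?thesis
      by (simp add: abs_mult mult.left_commute)
  qed
  then show ?thesis by blast
qed

text \<open>
Iterating the one-dimensional step suffices for the application: a functional that is not within \<open>\<epsilon>\<close> of
the span of \<open>\<delta> 0, ..., \<delta> (k - 1)\<close> exceeds \<open>\<epsilon>\<close> at some unit vector of their common
kernel.
\<close>
lemma functional_extension_finite_codim:
  fixes W :: "'b::real_normed_vector set" and \<delta> :: "nat \<Rightarrow> 'b \<Rightarrow> real"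
  assumes W: "subspace W" and \<delta>: "\<And>i. functional_on W (\<delta> i)" and "0 \<le> \<epsilon>"
    and "functional_on W \<psi>"
    and "\<And>w. w \<in> W \<Longrightarrow> (\<And>i. i < k \<Longrightarrow> \<delta> i w = 0) \<Longrightarrow> \<bar>\<psi> w\<bar> \<le> \<epsilon> * norm w"
  shows "\<exists>c. \<forall>w\<in>W. \<bar>\<psi> w - (\<Sum>i<k. c i * \<delta> i w)\<bar> \<le> \<epsilon> * norm w"
  using assms(4,5)
proof (induction k arbitrary: \<psi>)
  case 0
  then show ?case by simp
next
  case (Suc k)
  define W' where "W' = {w \<in> W. \<forall>i<k. \<delta> i w = 0}"
  have W': "subspace W'"
  proof (rule subspaceI)
    show "0 \<in> W'"
      using functional_on_scale[OF \<delta> subspace_0[OF W], of _ 0] subspace_0[OF W] by (simp add: W'_def)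
    show "x + y \<in> W'" if "x \<in> W'" "y \<in> W'" for x y
      using that W functional_on_add[OF \<delta>] by (auto simp: W'_def subspace_add)
    show "c *\<^sub>R x \<in> W'" if "x \<in> W'" for c x
      using that W functional_on_scale[OF \<delta>] by (auto simp: W'_def subspace_scale)
  qed
  have sub: "W' \<subseteq> W" by (auto simp: W'_def)
  have "\<exists>c. \<forall>w\<in>W'. \<bar>\<psi> w - c * \<delta> k w\<bar> \<le> \<epsilon> * norm w"
  proof (rule functional_extension_step[OF W' _ _ \<open>0 \<le> \<epsilon>\<close>])
    show "functional_on W' \<psi>" "functional_on W' (\<delta> k)"
      using Suc.prems(1) \<delta> sub functional_on_subset by blast+
    show "\<bar>\<psi> w\<bar> \<le> \<epsilon> * norm w" if "w \<in> W'" "\<delta> k w = 0" for w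
      using that by (intro Suc.prems(2)) (auto simp: W'_def less_Suc_eq)
  qed
  then obtain a where a: "\<And>w. w \<in> W' \<Longrightarrow> \<bar>\<psi> w - a * \<delta> k w\<bar> \<le> \<epsilon> * norm w" by blast
  have "\<exists>c. \<forall>w\<in>W. \<bar>(\<psi> w - a * \<delta> k w) - (\<Sum>i<k. c i * \<delta> i w)\<bar> \<le> \<epsilon> * norm w"
  proof (rule Suc.IH)
    show "functional_on W (\<lambda>w. \<psi> w - a * \<delta> k w)"
      using functional_on_add[OF Suc.prems(1)] functional_on_scale[OF Suc.prems(1)]
        functional_on_add[OF \<delta>] functional_on_scale[OF \<delta>]
      by (auto simp: functional_on_def algebra_simps)
    show "\<bar>\<psi> w - a * \<delta> k w\<bar> \<le> \<epsilon> * norm w" if "w \<in> W" "\<And>i. i < k \<Longrightarrow> \<delta> i w = 0" for w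
      using that by (intro a) (auto simp: W'_def)
  qed
  then obtain c where c: "\<And>w. w \<in> W \<Longrightarrow> \<bar>(\<psi> w - a * \<delta> k w) - (\<Sum>i<k. c i * \<delta> i w)\<bar> \<le> \<epsilon> * norm w"
    by blast
  have "\<bar>\<psi> w - (\<Sum>i<Suc k. (c(k := a)) i * \<delta> i w)\<bar> \<le> \<epsilon> * norm w" if "w \<in> W" for w
    using c[OF that] by (simp add: algebra_simps)
  then show ?case by blast
qed

context orbit_separable_action
begin

abbreviation "\<V> \<equiv> coords ` little"

lemma functional_ev: "W \<subseteq> \<V> \<Longrightarrow> x \<in> M \<Longrightarrow> functional_on W (\<lambda>w. ev w x)"
  unfolding functional_on_def using ev_add ev_scale by blast

lemma functional_dual: "\<phi> \<in> dual W \<Longrightarrow> functional_on W \<phi>"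
  by (auto simp: functional_on_def dual_def)

text \<open>
The unit ball is equicontinuous for \<open>orbit_dist\<close>, so convergence on \<open>D\<close> implies convergence everywhere.
\<close>
lemma pointwise_null_of_vanishing_at_D:
  assumes u: "\<And>k. u k \<in> \<V>" "\<And>k. norm (u k) \<le> 1"
    and zero: "\<And>k i. i < k \<Longrightarrow> ev (u k) (D i) = 0"
    and x: "x \<in> M"
  shows "(\<lambda>k. \<bar>ev (u k) x\<bar>) \<longlonglongrightarrow> 0"
proof (rule LIMSEQ_I)
  fix e :: real assume e: "e > 0"
  obtain n where n: "(1/2) ^ n < e / 2"
    using real_arch_pow_inv[of "e/2" "1/2"] e by auto
  obtain i where i: "orbit_dist x (D i) < e / 2 / 2 ^ n"
    using D_dense[OF x, of "e / 2 / 2 ^ n"] e by auto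
  have "norm (\<bar>ev (u k) x\<bar> - 0) < e" if k: "Suc i \<le> k" for k
  proof -
    have "norm_le (ev (u k)) 1"
      using norm_le_ev u by blast
    then have "\<bar>ev (u k) x - ev (u k) (D i)\<bar> \<le> 1 * weight n x (D i)"
      using x D_in by (rule norm_leD2)
    also have "\<dots> < e"
    proof -
      have "2 ^ n * orbit_dist x (D i) < e / 2"
        using i by (simp add: pos_less_divide_eq ac_simps)
      then show ?thesis using n by (simp add: weight_def)
    qed
    finally show ?thesis using zero[of i k] k by simp
  qed
  then show "\<exists>K. \<forall>k\<ge>K. norm (\<bar>ev (u k) x\<bar> - 0) < e" by blast
qed

text \<open>
Convex combinations preserve the norm bound and the lower bound for \<open>\<phi>\<close>. So Simons' argument, applied to the
absolute values of the functions, yields uniformly small vectors on which \<open>\<phi>\<close> is still large.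
\<close>
lemma uniformly_small_of_pointwise_null:
  assumes W: "subspace W" "W \<subseteq> \<V>" and \<phi>: "functional_on W \<phi>"
    and u: "\<And>k. u k \<in> W" "\<And>k. norm (u k) \<le> 1" "\<And>k. \<epsilon> \<le> \<phi> (u k)"
    and null: "\<And>x. x \<in> M \<Longrightarrow> (\<lambda>k. \<bar>ev (u k) x\<bar>) \<longlonglongrightarrow> 0"
    and "\<delta> > 0"
  obtains w where "w \<in> W" "norm w \<le> 1" "\<epsilon> \<le> \<phi> w" "\<And>x. x \<in> M \<Longrightarrow> \<bar>ev w x\<bar> \<le> \<delta>"
proof -
  have uV: "u k \<in> \<V>" for k using u(1) W(2) by blast
  have "\<exists>m\<in>mixtures (range (\<lambda>k x. \<bar>ev (u k) x\<bar>)). \<forall>x\<in>topspace mtopology. m x \<le> \<delta>"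
  proof (rule pointwise_null_imp_small_mixture[OF compact_M])
    show "continuous_map mtopology euclideanreal (\<lambda>x. \<bar>ev (u k) x\<bar>)" for k
      using ev_little[OF uV] by (intro continuous_map_real_abs) (auto simp: little_def)
    show "0 \<le> \<bar>ev (u k) x\<bar> \<and> \<bar>ev (u k) x\<bar> \<le> 1" if "x \<in> topspace mtopology" for k x
      using ev_le_norm[OF uV, of x k] u(2)[of k] that by simp
  qed (use null \<open>\<delta> > 0\<close> in auto)
  then obtain m where m: "m \<in> mixtures (range (\<lambda>k x. \<bar>ev (u k) x\<bar>))" "\<And>x. x \<in> M \<Longrightarrow> m x \<le> \<delta>"
    by auto
  from m(1) have "\<exists>w\<in>W. norm w \<le> 1 \<and> \<epsilon> \<le> \<phi> w \<and> (\<forall>x\<in>M. \<bar>ev w x\<bar> \<le> m x)"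
  proof induction
    case (base f)
    then show ?case using u by auto
  next
    case (mix f g t)
    obtain v where v: "v \<in> W" "norm v \<le> 1" "\<epsilon> \<le> \<phi> v" "\<And>x. x \<in> M \<Longrightarrow> \<bar>ev v x\<bar> \<le> f x"
      using mix.IH(1) by blast
    obtain w where w: "w \<in> W" "norm w \<le> 1" "\<epsilon> \<le> \<phi> w" "\<And>x. x \<in> M \<Longrightarrow> \<bar>ev w x\<bar> \<le> g x"
      using mix.IH(2) by blast
    let ?z = "(1 - t) *\<^sub>R v + t *\<^sub>R w"
    have s: "(1 - t) *\<^sub>R v \<in> W" "t *\<^sub>R w \<in> W"
      using W(1) v(1) w(1) by (auto intro: subspace_scale)
    have t: "0 \<le> 1 - t" "0 \<le> t" using mix.hyps by auto
    have "?z \<in> W" using W(1) s by (rule subspace_add)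
    moreover have "norm ?z \<le> 1"
    proof -
      have "norm ?z \<le> (1 - t) * norm v + t * norm w"
        using norm_triangle_ineq[of "(1 - t) *\<^sub>R v" "t *\<^sub>R w"] t by simp
      also have "\<dots> \<le> (1 - t) * 1 + t * 1"
        using v(2) w(2) t by (intro add_mono mult_left_mono)
      finally show ?thesis by simp
    qed
    moreover have "\<epsilon> \<le> \<phi> ?z"
    proof -
      have "\<epsilon> = (1 - t) * \<epsilon> + t * \<epsilon>" by (simp add: algebra_simps)
      also have "\<dots> \<le> (1 - t) * \<phi> v + t * \<phi> w"
        using v(3) w(3) t by (intro add_mono mult_left_mono)
      also have "\<dots> = \<phi> ?z"
        using functional_on_add[OF \<phi> s] functional_on_scale[OF \<phi>] v(1) w(1) by simp
      finally show ?thesis .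
    qed
    moreover have "\<bar>ev ?z x\<bar> \<le> (1 - t) * f x + t * g x" if x: "x \<in> M" for x
    proof -
      have "ev ?z x = (1 - t) * ev v x + t * ev w x"
        using W(2) s v(1) w(1) x by (simp add: ev_add ev_scale subset_iff)
      also have "\<bar>\<dots>\<bar> \<le> (1 - t) * \<bar>ev v x\<bar> + t * \<bar>ev w x\<bar>"
        using abs_triangle_ineq[of "(1 - t) * ev v x" "t * ev w x"] t by (simp add: abs_mult)
      also have "\<dots> \<le> (1 - t) * f x + t * g x"
        using v(4)[OF x] w(4)[OF x] t by (intro add_mono mult_left_mono)
      finally show ?thesis .
    qed
    ultimately show ?case by blast
  qed
  then show ?thesis using that m(2) by (meson order_trans)
qed

text \<open>
To \<open>s\<close> a uniformly small \<open>u\<close> of norm at most 1 is added. For large \<open>n\<close> the seminorm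
\<open>N\<^sub>n s\<close> is negligible and \<open>N\<^sub>n u \<le> 1\<close>; for small \<open>n\<close> it is \<open>N\<^sub>n u\<close> that is negligible. So the norm
hardly grows, while \<open>\<phi>\<close> grows by \<open>\<epsilon>\<close> each time.
\<close>
lemma gliding_hump:
  assumes W: "subspace W" "W \<subseteq> \<V>" and \<phi>: "functional_on W \<phi>" and "\<eta> > 0"
    and small: "\<And>\<delta>. \<delta> > 0 \<Longrightarrow> \<exists>u\<in>W. norm u \<le> 1 \<and> \<epsilon> \<le> \<phi> u \<and> (\<forall>x\<in>M. \<bar>ev u x\<bar> \<le> \<delta>)"
  shows "\<exists>s\<in>W. norm s \<le> 1 + real m * \<eta> \<and> real m * \<epsilon> \<le> \<phi> s"
proof (induction m)
  case 0
  have "\<phi> 0 = 0"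
    using functional_on_scale[OF \<phi> subspace_0[OF W(1)], of 0] by simp
  then show ?case using subspace_0[OF W(1)] by (intro bexI[of _ 0]) auto
next
  case (Suc m)
  then obtain s where s: "s \<in> W" "norm s \<le> 1 + real m * \<eta>" "real m * \<epsilon> \<le> \<phi> s" by blast
  define C where "C = 1 + real m * \<eta>"
  have C: "1 \<le> C" using \<open>\<eta> > 0\<close> by (simp add: C_def)
  have sV: "s \<in> \<V>" using s(1) W(2) by blast
  have nls: "norm_le (ev s) C"
    using norm_le_ev[OF sV] s(2) by (simp add: C_def)
  obtain N where N: "\<And>n x y. N \<le> n \<Longrightarrow> x \<in> M \<Longrightarrow> y \<in> M \<Longrightarrow> \<bar>ev s x - ev s y\<bar> \<le> \<eta> * weight n x y"
    using vanishingD[of "ev s" \<eta>] ev_little[OF sV] \<open>\<eta> > 0\<close> by (auto simp: little_def)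
  define \<delta> where "\<delta> = \<eta> * (1/2) ^ N / 2"
  have \<delta>: "\<delta> > 0" "2 * \<delta> = \<eta> * (1/2) ^ N" using \<open>\<eta> > 0\<close> by (auto simp: \<delta>_def)
  have "\<eta> * (1/2) ^ N \<le> \<eta> * 1"
    using \<open>\<eta> > 0\<close> by (intro mult_left_mono power_le_one) auto
  then have \<delta>\<eta>: "\<delta> \<le> \<eta>" using \<delta> by linarith
  obtain u where u: "u \<in> W" "norm u \<le> 1" "\<epsilon> \<le> \<phi> u" "\<And>x. x \<in> M \<Longrightarrow> \<bar>ev u x\<bar> \<le> \<delta>"
    using small[OF \<delta>(1)] by blast
  have uV: "u \<in> \<V>" using u(1) W(2) by blast
  have nlu: "norm_le (ev u) 1" using norm_le_ev[OF uV] u(2) by blast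
  have suW: "s + u \<in> W" using W(1) s(1) u(1) by (rule subspace_add)
  have ev_su: "ev (s + u) x = ev s x + ev u x" if "x \<in> M" for x
    by (rule ev_add[OF sV uV that])
  have "norm_le (ev (s + u)) (C + \<eta>)"
  proof (rule norm_leI)
    show "\<bar>ev (s + u) x\<bar> \<le> C + \<eta>" if x: "x \<in> M" for x
      using norm_leD1[OF nls x] u(4)[OF x] \<delta>\<eta> ev_su[OF x] by linarith
    show "\<bar>ev (s + u) x - ev (s + u) y\<bar> \<le> (C + \<eta>) * weight n x y" if xy: "x \<in> M" "y \<in> M" for n x y
    proof -
      have w: "0 < weight n x y" by (rule weight_pos[OF xy])
      have "\<bar>ev (s + u) x - ev (s + u) y\<bar> \<le> \<bar>ev s x - ev s y\<bar> + \<bar>ev u x - ev u y\<bar>"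
        using ev_su[OF xy(1)] ev_su[OF xy(2)] by linarith
      also have "\<dots> \<le> C * weight n x y + \<eta> * weight n x y"
      proof (cases "N \<le> n")
        case True
        have "\<bar>ev u x - ev u y\<bar> \<le> 1 * weight n x y"
          by (rule norm_leD2[OF nlu xy])
        also have "\<dots> \<le> C * weight n x y"
          using C w by (intro mult_right_mono) auto
        finally show ?thesis using N[OF True xy] by linarith
      next
        case False
        have "\<bar>ev u x - ev u y\<bar> \<le> \<eta> * (1/2) ^ N"
          using u(4)[OF xy(1)] u(4)[OF xy(2)] \<delta>(2) by linarith
        also have "\<dots> \<le> \<eta> * (1/2) ^ n"
          using False \<open>\<eta> > 0\<close> by (intro mult_left_mono power_decreasing) auto
        also have "\<dots> \<le> \<eta> * weight n x y"
          using \<open>\<eta> > 0\<close> weight_ge(1)[OF xy] by (intro mult_left_mono) auto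
        finally show ?thesis using norm_leD2[OF nls xy, of n] by linarith
      qed
      finally show ?thesis by (simp add: distrib_right)
    qed
  qed
  then have "norm (s + u) \<le> C + \<eta>"
    using norm_le_ev[of "s + u"] suW W(2) by blast
  then have "norm (s + u) \<le> 1 + real (Suc m) * \<eta>"
    by (simp add: C_def algebra_simps)
  moreover have "real (Suc m) * \<epsilon> \<le> \<phi> (s + u)"
    using functional_on_add[OF \<phi> s(1) u(1)] s(3) u(3) by (simp add: algebra_simps)
  ultimately show ?case using suW by blast
qed

text \<open>
If \<open>\<phi>\<close> were further than \<open>\<epsilon>\<close> from all combinations of the evaluations at points of \<open>D\<close>, there
would be vectors \<open>u k\<close> of norm at most 1 vanishing at \<open>D 0, ..., D (k - 1)\<close> with \<open>\<phi> (u k) \<ge> \<epsilon>\<close>. They tend to 0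
pointwise, mixtures of them are uniformly small, and the sums of the gliding hump contradict the boundedness of \<open>\<phi>\<close>.
\<close>
lemma point_evaluations_norm_dense:
  assumes W: "subspace W" "W \<subseteq> \<V>" and \<phi>: "\<phi> \<in> dual W" and "\<epsilon> > 0"
  shows "\<exists>k c. \<forall>w\<in>W. \<bar>\<phi> w - (\<Sum>i<k. c i * ev w (D i))\<bar> \<le> \<epsilon> * norm w"
proof (rule ccontr)
  assume neg: "\<not> ?thesis"
  have f\<phi>: "functional_on W \<phi>" by (rule functional_dual[OF \<phi>])
  have ex_kernel: "\<exists>w\<in>W. norm w \<le> 1 \<and> \<epsilon> \<le> \<phi> w \<and> (\<forall>i<k. ev w (D i) = 0)" for k
  proof -
    have "\<not> (\<forall>w\<in>W. (\<forall>i<k. ev w (D i) = 0) \<longrightarrow> \<bar>\<phi> w\<bar> \<le> \<epsilon> * norm w)"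
    proof
      assume small: "\<forall>w\<in>W. (\<forall>i<k. ev w (D i) = 0) \<longrightarrow> \<bar>\<phi> w\<bar> \<le> \<epsilon> * norm w"
      have "\<exists>c. \<forall>w\<in>W. \<bar>\<phi> w - (\<Sum>i<k. c i * ev w (D i))\<bar> \<le> \<epsilon> * norm w"
        by (rule functional_extension_finite_codim[OF W(1) functional_ev[OF W(2) D_in] _ f\<phi>])
          (use \<open>\<epsilon> > 0\<close> small in auto)
      then show False using neg by blast
    qed
    then obtain w where w: "w \<in> W" "\<And>i. i < k \<Longrightarrow> ev w (D i) = 0" "\<epsilon> * norm w < \<bar>\<phi> w\<bar>"
      by (auto simp: not_le)
    have "norm w > 0"
    proof (rule ccontr)
      assume "\<not> norm w > 0"
      then have "w = 0" by simp
      then show False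
        using functional_on_scale[OF f\<phi> w(1), of 0] w(3) by simp
    qed
    define a where "a = sgn (\<phi> w) / norm w"
    have "\<epsilon> * norm w > 0" using \<open>norm w > 0\<close> \<open>\<epsilon> > 0\<close> by simp
    then have "\<phi> w \<noteq> 0" using w(3) by linarith
    have "norm (a *\<^sub>R w) = 1"
      using \<open>norm w > 0\<close> \<open>\<phi> w \<noteq> 0\<close> by (simp add: a_def abs_divide abs_sgn_eq)
    moreover have "\<phi> (a *\<^sub>R w) = \<bar>\<phi> w\<bar> / norm w"
      using functional_on_scale[OF f\<phi> w(1), of a] by (simp add: a_def abs_sgn mult.commute)
    then have "\<epsilon> \<le> \<phi> (a *\<^sub>R w)"
      using w(3) \<open>norm w > 0\<close> by (simp add: pos_le_divide_eq)
    moreover have "ev (a *\<^sub>R w) (D i) = 0" if "i < k" for i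
      using ev_scale[of w "D i" a] w(1,2) W(2) that D_in by auto
    ultimately show ?thesis
      using subspace_scale[OF W(1) w(1), of a] by (intro bexI[of _ "a *\<^sub>R w"]) auto
  qed
  then have "\<forall>k. \<exists>w. w \<in> W \<and> norm w \<le> 1 \<and> \<epsilon> \<le> \<phi> w \<and> (\<forall>i<k. ev w (D i) = 0)" by blast
  then obtain u where u: "\<And>k. u k \<in> W" "\<And>k. norm (u k) \<le> 1" "\<And>k. \<epsilon> \<le> \<phi> (u k)"
    "\<And>k i. i < k \<Longrightarrow> ev (u k) (D i) = 0"
    by metis
  have null: "(\<lambda>k. \<bar>ev (u k) x\<bar>) \<longlonglongrightarrow> 0" if "x \<in> M" for x
    by (rule pointwise_null_of_vanishing_at_D[OF _ u(2,4) that]) (use u(1) W(2) in auto)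
  have small: "\<exists>w\<in>W. norm w \<le> 1 \<and> \<epsilon> \<le> \<phi> w \<and> (\<forall>x\<in>M. \<bar>ev w x\<bar> \<le> \<delta>)" if "\<delta> > 0" for \<delta>
    by (rule uniformly_small_of_pointwise_null[OF W f\<phi> u(1-3) null that]) auto
  obtain B where B: "\<And>w. w \<in> W \<Longrightarrow> \<bar>\<phi> w\<bar> \<le> B * norm w"
    using dual_bounded[OF \<phi>] by blast
  define b where "b = \<bar>B\<bar> + 1"
  have b: "b > 0" by (simp add: b_def)
  have B': "\<phi> w \<le> b * norm w" if "w \<in> W" for w
  proof -
    have "\<phi> w \<le> B * norm w" using B[OF that] by linarith
    also have "\<dots> \<le> b * norm w" by (intro mult_right_mono) (auto simp: b_def)
    finally show ?thesis .
  qed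
  \<comment> \<open>The growth of the norm per step, so slow that \<open>b * \<eta>\<close> stays below the gain \<open>\<epsilon>\<close> of \<open>\<phi>\<close>.\<close>
  define \<eta> where "\<eta> = \<epsilon> / (2 * b)"
  have \<eta>: "\<eta> > 0" "b * \<eta> = \<epsilon> / 2" using b \<open>\<epsilon> > 0\<close> by (auto simp: \<eta>_def)
  obtain m where m: "2 * b / \<epsilon> < real m" using reals_Archimedean2 by blast
  obtain s where s: "s \<in> W" "norm s \<le> 1 + real m * \<eta>" "real m * \<epsilon> \<le> \<phi> s"
    using gliding_hump[OF W f\<phi> \<eta>(1) small, of m] by blast
  have "real m * \<epsilon> \<le> b * (1 + real m * \<eta>)"
    using s(3) B'[OF s(1)] mult_left_mono[OF s(2), of b] b by linarith
  also have "\<dots> = b + real m * (b * \<eta>)" by (simp add: algebra_simps)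
  also have "\<dots> = b + real m * (\<epsilon> / 2)" unfolding \<eta>(2) ..
  finally have "real m * \<epsilon> \<le> 2 * b" by linarith
  then show False using m \<open>\<epsilon> > 0\<close> by (simp add: pos_divide_less_eq)
qed

theorem separable_dual_subspace:
  assumes bW: "banach_subspace W" and WV: "W \<subseteq> \<V>"
  shows "separable_dual W"
proof -
  have W: "subspace W" using bW by (simp add: banach_subspace_def)
  define E where "E l = (\<lambda>w\<in>W. \<Sum>i<length l. of_rat (l ! i) * ev w (D i))" for l :: "rat list"
  have E_dual: "E l \<in> dual W" for l
    unfolding dual_def
  proof (intro CollectI conjI ballI allI)
    show "E l \<in> extensional W" by (simp add: E_def)
    show "E l (v + w) = E l v + E l w" if "v \<in> W" "w \<in> W" for v w
      using that WV W D_in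
      by (simp add: E_def subspace_add ev_add subset_iff distrib_left sum.distrib)
    show "E l (c *\<^sub>R v) = c * E l v" if "v \<in> W" for c v
      using that WV W D_in
      by (simp add: E_def subspace_scale ev_scale subset_iff sum_distrib_left mult.left_commute)
    show "\<exists>B. \<forall>v\<in>W. \<bar>E l v\<bar> \<le> B * norm v"
    proof (intro exI ballI)
      fix v assume v: "v \<in> W"
      have "\<bar>E l v\<bar> \<le> (\<Sum>i<length l. \<bar>of_rat (l ! i) * ev v (D i)\<bar>)"
        using v by (simp add: E_def sum_abs)
      also have "\<dots> \<le> (\<Sum>i<length l. \<bar>of_rat (l ! i)\<bar> * norm v)"
        using ev_le_norm[of v] v WV D_in by (intro sum_mono) (auto simp: abs_mult intro!: mult_left_mono)
      also have "\<dots> = (\<Sum>i<length l. \<bar>of_rat (l ! i)\<bar>) * norm v"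
        by (simp add: sum_distrib_right)
      finally show "\<bar>E l v\<bar> \<le> (\<Sum>i<length l. \<bar>of_rat (l ! i)\<bar>) * norm v" .
    qed
  qed
  have "\<exists>l. dual_norm W (\<lambda>v. \<phi> v - E l v) < e" if \<phi>: "\<phi> \<in> dual W" and e: "e > 0" for \<phi> e
  proof -
    obtain k c where kc: "\<And>w. w \<in> W \<Longrightarrow> \<bar>\<phi> w - (\<Sum>i<k. c i * ev w (D i))\<bar> \<le> e/3 * norm w"
      using point_evaluations_norm_dense[OF W WV \<phi>, of "e/3"] e by auto
    define \<rho> where "\<rho> = e / 3 / (real k + 1)"
    have \<rho>: "\<rho> > 0" using e by (simp add: \<rho>_def)
    have "\<exists>q. \<bar>c i - of_rat q\<bar> < \<rho>" for i
    proof -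
      obtain q where "c i < of_rat q" "of_rat q < c i + \<rho>"
        using of_rat_dense[of "c i" "c i + \<rho>"] \<rho> by auto
      then have "\<bar>c i - of_rat q\<bar> < \<rho>" by linarith
      then show ?thesis ..
    qed
    then obtain q where q: "\<And>i. \<bar>c i - of_rat (q i)\<bar> < \<rho>" by metis
    define l where "l = map q [0..<k]"
    have E_l: "E l w = (\<Sum>i<k. of_rat (q i) * ev w (D i))" if "w \<in> W" for w
      using that by (simp add: E_def l_def)
    have bound: "\<bar>\<phi> w - E l w\<bar> \<le> 2 * e / 3" if w: "w \<in> W" "norm w \<le> 1" for w
    proof -
      have "\<bar>(\<Sum>i<k. c i * ev w (D i)) - E l w\<bar> = \<bar>\<Sum>i<k. (c i - of_rat (q i)) * ev w (D i)\<bar>"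
        by (simp add: E_l w(1) sum_subtractf left_diff_distrib)
      also have "\<dots> \<le> (\<Sum>i<k. \<bar>(c i - of_rat (q i)) * ev w (D i)\<bar>)"
        by (rule sum_abs)
      also have "\<dots> \<le> (\<Sum>i<k. \<rho> * 1)"
      proof (rule sum_mono)
        fix i
        have "\<bar>ev w (D i)\<bar> \<le> 1"
          using ev_le_norm[of w "D i"] w WV D_in by force
        then show "\<bar>(c i - of_rat (q i)) * ev w (D i)\<bar> \<le> \<rho> * 1"
          using q[of i] \<rho> unfolding abs_mult by (intro mult_mono) auto
      qed
      also have "\<dots> \<le> e / 3"
        using e by (simp add: \<rho>_def field_simps)
      finally have "\<bar>(\<Sum>i<k. c i * ev w (D i)) - E l w\<bar> \<le> e / 3" .
      moreover have "\<bar>\<phi> w - (\<Sum>i<k. c i * ev w (D i))\<bar> \<le> e / 3"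
        using kc[OF w(1)] mult_left_mono[OF w(2), of "e/3"] e by linarith
      ultimately show ?thesis by linarith
    qed
    have "dual_norm W (\<lambda>v. \<phi> v - E l v) \<le> 2 * e / 3"
      unfolding dual_norm_def using bound subspace_0[OF W] by (intro cSUP_least) auto
    then show ?thesis using e by (intro exI[of _ l]) linarith
  qed
  then show ?thesis
    unfolding separable_dual_def using E_dual by (intro exI[of _ "range E"]) auto
qed

theorem asplund_\<V>: "asplund \<V>"
  unfolding asplund_def using banach_subspace_coords separable_dual_subspace by blast

end

section \<open>The representation of a system with separable orbit metric\<close>

lemma Hausdorff_space_weak_star: "Hausdorff_space (weak_star V)"
  unfolding weak_star_def
  by (intro Hausdorff_space_subtopology) (simp add: Hausdorff_space_product_topology)

context orbit_separable_action
begin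

text \<open>
Composition with the action, \<open>v \<mapsto> v \<circ> g\<close>, transported to coordinate sequences. It reverses products,
hence is a co-homomorphism, and it is isometric because all weights are invariant.
\<close>
definition transl :: "'g \<Rightarrow> (nat discrete \<Rightarrow>\<^sub>C real) \<Rightarrow> (nat discrete \<Rightarrow>\<^sub>C real)" where
  "transl g = (\<lambda>w\<in>\<V>. coords (\<lambda>x. ev w (act g x)))"

definition point_eval :: "'x \<Rightarrow> (nat discrete \<Rightarrow>\<^sub>C real) \<Rightarrow> real" where
  "point_eval x = (\<lambda>w\<in>\<V>. ev w x)"

lemma transl_in: "w \<in> \<V> \<Longrightarrow> transl g w \<in> \<V>"
  by (simp add: transl_def little_act ev_little)

lemma ev_transl: "w \<in> \<V> \<Longrightarrow> x \<in> M \<Longrightarrow> ev (transl g w) x = ev w (act g x)"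
  by (simp add: transl_def ev_coords little_act ev_little)

lemma \<V>_eqI:
  assumes "v \<in> \<V>" "w \<in> \<V>" "\<And>x. x \<in> M \<Longrightarrow> ev v x = ev w x"
  shows "v = w"
  using coords_cong[of "ev v" "ev w"] assms by (simp add: coords_ev)

lemma transl_add: "w \<in> \<V> \<Longrightarrow> transl (g + g') w = transl g' (transl g w)"
  by (rule \<V>_eqI) (simp_all add: transl_in ev_transl act_in act_add)

lemma transl_zero: "w \<in> \<V> \<Longrightarrow> transl 0 w = w"
  by (rule \<V>_eqI) (simp_all add: transl_in ev_transl act_zero)

lemma subspace_\<V>: "subspace \<V>"
  using banach_subspace_coords by (simp add: banach_subspace_def)

lemma transl_Iso: "transl g \<in> Iso \<V>"
  unfolding Iso_def
proof (intro CollectI conjI ballI allI)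
  show "transl g \<in> extensional \<V>" by (simp add: transl_def)
  have inv: "transl (- g) (transl g w) = w" "transl g (transl (- g) w) = w" if "w \<in> \<V>" for g w
    using that by (simp_all add: transl_zero flip: transl_add)
  show "bij_betw (transl g) \<V> \<V>"
    by (rule bij_betw_byWitness[of _ "transl (- g)"]) (use inv transl_in in blast)+
  show "transl g (v + w) = transl g v + transl g w" if v: "v \<in> \<V>" and w: "w \<in> \<V>" for v w
  proof (rule \<V>_eqI)
    have vw: "v + w \<in> \<V>" by (rule subspace_add[OF subspace_\<V> v w])
    show "transl g (v + w) \<in> \<V>" by (rule transl_in[OF vw])
    show "transl g v + transl g w \<in> \<V>"
      by (rule subspace_add[OF subspace_\<V> transl_in[OF v] transl_in[OF w]])
    show "ev (transl g (v + w)) x = ev (transl g v + transl g w) x" if x: "x \<in> M" for x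
      using ev_transl[OF vw x] ev_add[OF v w act_in[OF x]] ev_add[OF transl_in[OF v] transl_in[OF w] x]
        ev_transl[OF v x] ev_transl[OF w x] by simp
  qed
  show "transl g (c *\<^sub>R v) = c *\<^sub>R transl g v" if v: "v \<in> \<V>" for c v
  proof (rule \<V>_eqI)
    have cv: "c *\<^sub>R v \<in> \<V>" by (rule subspace_scale[OF subspace_\<V> v])
    show "transl g (c *\<^sub>R v) \<in> \<V>" by (rule transl_in[OF cv])
    show "c *\<^sub>R transl g v \<in> \<V>"
      by (rule subspace_scale[OF subspace_\<V> transl_in[OF v]])
    show "ev (transl g (c *\<^sub>R v)) x = ev (c *\<^sub>R transl g v) x" if x: "x \<in> M" for x
      using ev_transl[OF cv x] ev_scale[OF v act_in[OF x]] ev_scale[OF transl_in[OF v] x]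
        ev_transl[OF v x] by simp
  qed
  have le: "norm (transl g v) \<le> norm v" if v: "v \<in> \<V>" for g v
  proof -
    have "norm_le (ev v) (norm v)" using norm_le_ev[OF v] by blast
    then have "norm_le (\<lambda>x. ev v (act g x)) (norm v)" by (rule norm_le_act)
    then show ?thesis
      using norm_coords_le[OF little_act[OF ev_little[OF v]]] v by (simp add: transl_def)
  qed
  show "norm (transl g v) = norm v" if v: "v \<in> \<V>" for v
    using le[OF v, of g] le[OF transl_in[OF v], of "- g" g] inv(1)[OF v, of g] by simp
qed

lemma uniform_continuity_in_group:
  assumes v: "continuous_map mtopology euclideanreal v" and "\<delta> > 0"
  shows "\<exists>U. open U \<and> g\<^sub>0 \<in> U \<and> (\<forall>g\<in>U. \<forall>x\<in>M. \<bar>v (act g x) - v (act g\<^sub>0 x)\<bar> < \<delta>)"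
proof -
  let ?P = "prod_topology (euclidean :: 'g topology) mtopology"
  have "continuous_map ?P euclideanreal (\<lambda>(g, x). v (act g x))"
    using continuous_map_compose[OF act_continuous v] by (simp add: o_def case_prod_unfold)
  moreover have "continuous_map ?P euclideanreal (\<lambda>(g, x). v (act g\<^sub>0 x))"
    using continuous_map_compose[OF continuous_map_snd continuous_map_compose[OF continuous_map_act v]]
    by (simp add: o_def case_prod_unfold)
  ultimately have "continuous_map ?P euclideanreal (\<lambda>z. (\<lambda>(g, x). v (act g x)) z - (\<lambda>(g, x). v (act g\<^sub>0 x)) z)"
    by (rule continuous_map_diff)
  then have "openin ?P {z \<in> topspace ?P. (\<lambda>(g, x). v (act g x)) z - (\<lambda>(g, x). v (act g\<^sub>0 x)) z \<in> ball 0 \<delta>}" (is "openin ?P ?W")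
    by (rule openin_continuous_map_preimage) auto
  moreover have "{g\<^sub>0} \<times> M \<subseteq> ?W" using \<open>\<delta> > 0\<close> by auto
  moreover have "compactin mtopology M" using compact_M by (simp add: compact_space_def)
  ultimately obtain U V where U: "openin euclidean U" "g\<^sub>0 \<in> U" and UV: "M \<subseteq> V" "U \<times> V \<subseteq> ?W"
    using tube_lemma_right[of euclidean mtopology ?W M g\<^sub>0] by auto
  have "\<bar>v (act g x) - v (act g\<^sub>0 x)\<bar> < \<delta>" if "g \<in> U" "x \<in> M" for g x
  proof -
    have "(g, x) \<in> ?W"
      using that UV by (meson SigmaI subsetD)
    then show ?thesis by simp
  qed
  moreover have "open U"
    using U(1) by (simp only: open_openin)
  ultimately show ?thesis
    using U(2) by blast
qed

text \<open>
By compactness \<open>v \<circ> g\<close> depends on \<open>g\<close> continuously in the supremum norm. This controls finitely many of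
the seminorms, and the others are small uniformly in \<open>g\<close> because they are invariant and vanish along \<open>n\<close>.
\<close>
lemma transl_strongly_continuous:
  assumes w: "w \<in> \<V>"
  shows "continuous_on UNIV (\<lambda>g. transl g w)"
  unfolding continuous_on_def tendsto_iff
proof (intro ballI allI impI)
  fix g\<^sub>0 :: 'g and e :: real assume e: "0 < e"
  have v: "ev w \<in> little" by (rule ev_little[OF w])
  then have vc: "continuous_map mtopology euclideanreal (ev w)" by (simp add: little_def)
  obtain N where N: "\<And>n x y. N \<le> n \<Longrightarrow> x \<in> M \<Longrightarrow> y \<in> M \<Longrightarrow> \<bar>ev w x - ev w y\<bar> \<le> e/4 * weight n x y"
    using vanishingD[of "ev w" "e/4"] v e by (auto simp: little_def)
  define \<delta> where "\<delta> = e/2 * (1/2) ^ N / 2"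
  have \<delta>: "\<delta> > 0" "2 * \<delta> = e/2 * (1/2) ^ N" using e by (auto simp: \<delta>_def)
  have "e/2 * (1/2) ^ N \<le> e/2 * 1"
    using e by (intro mult_left_mono power_le_one) auto
  then have \<delta>_e: "\<delta> \<le> e/2" using \<delta> by linarith
  obtain U where U: "open U" "g\<^sub>0 \<in> U"
    and U': "\<forall>g\<in>U. \<forall>x\<in>M. \<bar>ev w (act g x) - ev w (act g\<^sub>0 x)\<bar> < \<delta>"
    using uniform_continuity_in_group[OF vc \<delta>(1), of g\<^sub>0] by blast
  have "dist (transl g w) (transl g\<^sub>0 w) < e" if g: "g \<in> U" for g
  proof -
    let ?f = "\<lambda>x. ev w (act g x) - ev w (act g\<^sub>0 x)"
    have "norm_le ?f (e/2)"
    proof (rule norm_leI_split[where \<delta> = \<delta> and N = N])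
      show "\<bar>?f x\<bar> \<le> \<delta>" if "x \<in> M" for x
        using U' g that by (auto intro: less_imp_le)
      show "2 * \<delta> \<le> e/2 * (1/2) ^ N" "\<delta> \<le> e/2" "0 \<le> e/2"
        using \<delta> \<delta>_e e by auto
      show "\<bar>?f x - ?f y\<bar> \<le> e/2 * weight n x y" if n: "N \<le> n" and x: "x \<in> M" and y: "y \<in> M" for n x y
      proof -
        have "\<bar>ev w (act g x) - ev w (act g y)\<bar> \<le> e/4 * weight n x y"
          using N[OF n act_in[OF x] act_in[OF y], of g g] weight_act[OF x y] by simp
        moreover have "\<bar>ev w (act g\<^sub>0 x) - ev w (act g\<^sub>0 y)\<bar> \<le> e/4 * weight n x y"
          using N[OF n act_in[OF x] act_in[OF y], of g\<^sub>0 g\<^sub>0] weight_act[OF x y] by simp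
        ultimately show ?thesis by linarith
      qed
    qed
    then have "norm (coords ?f) \<le> e/2"
      using norm_coords_le[OF little_diff[OF little_act[OF v] little_act[OF v]]] by blast
    then have "norm (transl g w - transl g\<^sub>0 w) \<le> e/2"
      using w by (simp add: transl_def coords_diff little_act v)
    then show ?thesis using e by (simp add: dist_norm)
  qed
  then show "\<forall>\<^sub>F g in at g\<^sub>0 within UNIV. dist (transl g w) (transl g\<^sub>0 w) < e"
    using U(1,2) unfolding eventually_at_topological by blast
qed

lemma transl_cohom: "strongly_continuous_cohom \<V> transl"
  unfolding strongly_continuous_cohom_def
proof (intro conjI allI ballI)
  show "transl (g + g') = compose \<V> (transl g') (transl g)" for g g'
  proof
    show "transl (g + g') w = compose \<V> (transl g') (transl g) w" for w
      using transl_add[of w g g'] by (cases "w \<in> \<V>") (simp_all add: compose_def transl_def)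
  qed
qed (use transl_Iso transl_strongly_continuous in auto)

lemma point_eval_dual:
  assumes "x \<in> M"
  shows "point_eval x \<in> dual \<V>"
  unfolding dual_def
proof (intro CollectI conjI ballI allI)
  show "point_eval x \<in> extensional \<V>" by (simp add: point_eval_def)
  show "point_eval x (v + w) = point_eval x v + point_eval x w" if "v \<in> \<V>" "w \<in> \<V>" for v w
    using that ev_add[OF that assms] subspace_add[OF subspace_\<V> that] by (simp add: point_eval_def)
  show "point_eval x (c *\<^sub>R v) = c * point_eval x v" if "v \<in> \<V>" for c v
    using that ev_scale[OF that assms] subspace_scale[OF subspace_\<V> that] by (simp add: point_eval_def)
  show "\<exists>B. \<forall>v\<in>\<V>. \<bar>point_eval x v\<bar> \<le> B * norm v"
    using ev_le_norm assms by (intro exI[of _ 1]) (auto simp: point_eval_def)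
qed

text \<open>
These functions separate points, so the evaluations embed \<open>X\<close>; they are Lipschitz for \<open>orbit_dist\<close>.
\<close>
lemma dist_little:
  assumes "a \<in> M"
  shows "(\<lambda>x. d x a) \<in> little"
proof -
  have "continuous_map mtopology euclideanreal (\<lambda>x. d x a)"
  proof (rule continuous_map_realI)
    fix x and e :: real assume "x \<in> topspace mtopology" "e > 0"
    then have x: "x \<in> M" by simp
    have "\<bar>d y a - d x a\<bar> < e" if "y \<in> mball x e" for y
    proof -
      have "y \<in> M" "d x y < e" using that by auto
      then show ?thesis
        using triangle[OF x \<open>y \<in> M\<close> assms] triangle[OF \<open>y \<in> M\<close> x assms] commute[of x y] by linarith
    qed
    then show "\<exists>U. openin mtopology U \<and> x \<in> U \<and> (\<forall>y\<in>U. \<bar>d y a - d x a\<bar> < e)"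
      using x \<open>e > 0\<close> by (intro exI[of _ "mball x e"]) auto
  qed
  moreover have "vanishing (\<lambda>x. d x a)"
    unfolding vanishing_def
  proof (intro allI impI)
    fix e :: real assume e: "e > 0"
    obtain N where N: "(1/2) ^ N < e"
      using real_arch_pow_inv[of e "1/2"] e by auto
    have "\<bar>d x a - d y a\<bar> \<le> e * weight n x y" if n: "N \<le> n" and x: "x \<in> M" and y: "y \<in> M" for n x y
    proof -
      have "\<bar>d x a - d y a\<bar> \<le> d x y"
        using triangle[OF x y assms] triangle[OF y x assms] commute[of x y] by linarith
      also have "\<dots> \<le> orbit_dist x y"
        using dist_le_orbit_dist[OF x y, of 0] x y by (simp add: act_zero)
      also have "\<dots> = (1/2) ^ n * (2 ^ n * orbit_dist x y)"
        by (simp add: power_one_over)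
      also have "\<dots> \<le> e * weight n x y"
      proof (rule mult_mono)
        have "(1/2) ^ n \<le> (1/2 :: real) ^ N"
          using n by (intro power_decreasing) auto
        then show "(1/2) ^ n \<le> e" using N by linarith
        show "2 ^ n * orbit_dist x y \<le> weight n x y" by (rule weight_ge(2)[OF x y])
      qed (use e orbit_dist_nonneg[OF x y] in auto)
      finally show ?thesis .
    qed
    then show "\<exists>N. \<forall>n\<ge>N. \<forall>x\<in>M. \<forall>y\<in>M. \<bar>d x a - d y a\<bar> \<le> e * weight n x y" by blast
  qed
  ultimately show ?thesis by (simp add: little_def)
qed

lemma point_eval_embedding: "embedding_map mtopology (weak_star \<V>) point_eval"
proof (rule continuous_imp_embedding_map[OF _ compact_M Hausdorff_space_weak_star])
  have "continuous_map mtopology (product_topology (\<lambda>_. euclideanreal) \<V>) point_eval"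
    unfolding continuous_map_componentwise
  proof (intro conjI ballI)
    show "point_eval ` topspace mtopology \<subseteq> extensional \<V>" by (auto simp: point_eval_def)
    fix w assume w: "w \<in> \<V>"
    have "continuous_map mtopology euclideanreal (ev w)"
      using ev_little[OF w] by (simp add: little_def)
    then show "continuous_map mtopology euclideanreal (\<lambda>x. point_eval x w)"
      using w by (simp add: point_eval_def)
  qed
  then show "continuous_map mtopology (weak_star \<V>) point_eval"
    using point_eval_dual by (auto simp: weak_star_def continuous_map_in_subtopology)
  show "inj_on point_eval (topspace mtopology)"
  proof (rule inj_onI)
    fix x y assume "x \<in> topspace mtopology" "y \<in> topspace mtopology" and eq: "point_eval x = point_eval y"
    then have x: "x \<in> M" and y: "y \<in> M" by auto
    have "point_eval x (coords (\<lambda>z. d z y)) = point_eval y (coords (\<lambda>z. d z y))" by (simp add: eq)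
    then have "d x y = d y y"
      using x y by (simp add: point_eval_def dist_little ev_coords)
    then show "x = y" using x y by simp
  qed
qed

theorem RN_mtopology: "RN mtopology act"
  unfolding RN_def RN_over_def
proof (intro exI conjI ballI allI)
  show "asplund \<V>" by (rule asplund_\<V>)
  show "strongly_continuous_cohom \<V> transl" by (rule transl_cohom)
  show "embedding_map mtopology (weak_star \<V>) point_eval" by (rule point_eval_embedding)
  show "dual_norm \<V> (point_eval x) \<le> 1" if "x \<in> topspace mtopology" for x
    unfolding dual_norm_def
  proof (rule cSUP_least)
    show "{v \<in> \<V>. norm v \<le> 1} \<noteq> {}" using subspace_0[OF subspace_\<V>] by force
    show "\<bar>point_eval x v\<bar> \<le> 1" if "v \<in> {v \<in> \<V>. norm v \<le> 1}" for v
      using that \<open>x \<in> topspace mtopology\<close> ev_le_norm[of v x] by (auto simp: point_eval_def)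
  qed
  show "point_eval (act g x) = dual_action \<V> transl g (point_eval x)" if "x \<in> topspace mtopology" for g x
  proof
    show "point_eval (act g x) w = dual_action \<V> transl g (point_eval x) w" for w
      using that by (cases "w \<in> \<V>") (simp_all add: point_eval_def dual_action_def transl_in ev_transl)
  qed
qed

end

text \<open>
The empty system has no dense sequence of points; it is represented on the zero space.
\<close>
lemma RN_empty:
  assumes "topspace X = {}"
  shows "RN X (act :: 'g::topological_group_add \<Rightarrow> 'x \<Rightarrow> 'x)"
proof -
  let ?V = "{0 :: nat discrete \<Rightarrow>\<^sub>C real}"
  have X: "X = trivial_topology" using assms by simp
  have "separable_dual W" if "banach_subspace W" "W \<subseteq> ?V" for W
  proof -
    have W: "W = ?V"
      using that subspace_0 by (auto simp: banach_subspace_def)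
    define z where "z = (\<lambda>v\<in>?V. 0 :: real)"
    have "z \<in> dual W"
      by (auto simp: W z_def dual_def)
    moreover have "dual_norm W (\<lambda>v. f v - z v) < e" if "f \<in> dual W" "e > 0" for f e
      using that dual_scale[of f W 0 0] by (simp add: W z_def dual_norm_def)
    ultimately show ?thesis
      unfolding separable_dual_def by (intro exI[of _ "{z}"]) auto
  qed
  moreover have "banach_subspace ?V"
    by (simp add: banach_subspace_def)
  ultimately have V: "asplund ?V" by (simp add: asplund_def)
  have h: "strongly_continuous_cohom ?V (\<lambda>g::'g. \<lambda>v\<in>?V. v)"
    by (auto simp: strongly_continuous_cohom_def Iso_def compose_def bij_betw_def)
  have \<alpha>: "embedding_map X (weak_star ?V) (\<lambda>_. undefined)"
    by (rule continuous_imp_embedding_map[OF _ _ Hausdorff_space_weak_star]) (auto simp: X)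
  show ?thesis
    unfolding RN_def RN_over_def using V h \<alpha> assms by blast
qed

section \<open>The equivalence\<close>

theorem generic_continuity_imp_RN:
  assumes sys: "compact_metric_system X act"
    and gen: "\<And>Y. closedin X Y \<Longrightarrow> invariant_set act Y \<Longrightarrow> generic_continuity X act Y"
  shows "RN X act"
proof (cases "topspace X = {}")
  case True
  then show ?thesis by (rule RN_empty)
next
  case False
  have "metrizable_space X" using sys by (simp add: compact_metric_system_def)
  then obtain M d where "Metric_space M d" and X: "X = Metric_space.mtopology M d"
    unfolding metrizable_space_def by blast
  interpret Metric_space M d by fact
  interpret compact_metric_action M d act
    by unfold_locales (use sys X in simp)
  obtain C where C: "countable C" "C \<subseteq> M" "\<And>x e. x \<in> M \<Longrightarrow> e > 0 \<Longrightarrow> \<exists>y\<in>C. orbit_dist x y < e"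
    using orbit_dist_separable gen unfolding X by blast
  obtain a where "a \<in> M" using False X by auto
  then have "C \<noteq> {}" using C(3)[of a 1] by auto
  then have range: "range (from_nat_into C) = C"
    using C(1) by (rule range_from_nat_into)
  interpret orbit_separable_action M d act "from_nat_into C"
  proof
    show "from_nat_into C i \<in> M" for i
      using from_nat_into[OF \<open>C \<noteq> {}\<close>] C(2) by blast
    show "\<exists>i. orbit_dist x (from_nat_into C i) < e" if xe: "x \<in> M" "e > 0" for x e
    proof -
      obtain y where "y \<in> C" "orbit_dist x y < e" using C(3)[OF xe] by blast
      then show ?thesis using range by (metis rangeE)
    qed
  qed
  show ?thesis using RN_mtopology X by simp
qed

theorem corollary14p3:
  fixes X :: "'x topology"
    and act :: "'g::topological_group_add \<Rightarrow> 'x \<Rightarrow> 'x"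
  assumes "compact_metric_system X act"
  shows "(RN X act \<longleftrightarrow> (\<forall>Y. closedin X Y \<longrightarrow> generic_continuity X act Y)) \<and>
         (RN X act \<longleftrightarrow> (\<forall>Y. closedin X Y \<and> invariant_set act Y \<longrightarrow> generic_continuity X act Y)) \<and>
         (RN_over TYPE('b::banach) X act \<longrightarrow> RN X act)"
proof -
  have "generic_continuity X act Y" if "RN X act" "closedin X Y" for Y
    using RN_over_imp_generic_continuity[OF assms _ that(2)] that(1) unfolding RN_def by blast
  moreover have "RN X act" if "\<forall>Y. closedin X Y \<and> invariant_set act Y \<longrightarrow> generic_continuity X act Y"
    using generic_continuity_imp_RN[OF assms] that by blast
  moreover have "generic_continuity X act Y" if "RN_over TYPE('b) X act" "closedin X Y" for Y
    by (rule RN_over_imp_generic_continuity[OF assms that])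
  ultimately show ?thesis by blast
qed

end
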